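(* In the deterministic $\mathsf{LOCAL}$ model, there is no distributed algorithm that solves weak $2$-coloring on all graphs in which every node has odd degree and whose running time on graphs of maximum degree $\Delta$ is $T(\Delta)$ for some function $T$ with $T(\Delta)\in o(\log^*\Delta)$.
   Context: Weak $2$-coloring: each node outputs a color from $\{1,2\}$ such that every node of degree at least $1$ has at least one neighbor with a different color. $\mathsf{LOCAL}$ model: the nodes of the (simple, connected) input graph with $n$ nodes and maximum degree $\Delta$ are processors with globally unique identifiers that are $O(\log n)$-bit strings; each node knows $n$ and $\Delta$; computation proceeds in synchronous rounds in which every node sends arbitrarily large messages to its neighbors and performs arbitrary local computation; the running time is the number of rounds until all nodes have terminated and produced their outputs, in the worst case. $\log^*$ is the iterated logarithm. *)

theory Defs
  imports Complex_Main "HOL-Library.Landau_Symbols"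
begin

definition log_star :: "real \<Rightarrow> nat" where
  "log_star x = (LEAST k. ((\<lambda>y. log 2 y) ^^ k) x \<le> 1)"

text \<open>Graphs: vertices are the (unique) identifiers themselves, i.e. natural numbers;
  edges are 2-element subsets of the vertex set (simple undirected graph).\<close>
type_synonym graph = "nat set \<times> nat set set"

definition simple_graph :: "graph \<Rightarrow> bool" where
  "simple_graph G \<longleftrightarrow> finite (fst G) \<and> fst G \<noteq> {} \<and>
     (\<forall>e\<in>snd G. e \<subseteq> fst G \<and> card e = 2)"

definition nbrs :: "graph \<Rightarrow> nat \<Rightarrow> nat set" where
  "nbrs G v = {u. {u, v} \<in> snd G}"

definition deg :: "graph \<Rightarrow> nat \<Rightarrow> nat" where
  "deg G v = card (nbrs G v)"

definition max_deg :: "graph \<Rightarrow> nat" where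
  "max_deg G = Max (deg G ` fst G)"

fun reach_le :: "graph \<Rightarrow> nat \<Rightarrow> nat \<Rightarrow> nat \<Rightarrow> bool" where
  "reach_le G v u 0 \<longleftrightarrow> u = v \<and> v \<in> fst G"
| "reach_le G v u (Suc k) \<longleftrightarrow> reach_le G v u k \<or> (\<exists>w. reach_le G v w k \<and> {w, u} \<in> snd G)"

definition connected_graph :: "graph \<Rightarrow> bool" where
  "connected_graph G \<longleftrightarrow> (\<forall>u\<in>fst G. \<forall>w\<in>fst G. \<exists>k. reach_le G u w k)"

text \<open>The information a node v has gathered after T rounds of the LOCAL model:
  the identifiers of all nodes at distance at most T, all edges incident to a node at
  distance less than T, and the degree (initial knowledge) of every node at distance at most T.\<close>
type_synonym view = "nat set \<times> nat set set \<times> (nat \<Rightarrow> nat)"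

definition local_view :: "graph \<Rightarrow> nat \<Rightarrow> nat \<Rightarrow> view" where
  "local_view G T v =
     ({u. reach_le G v u T},
      {e \<in> snd G. \<exists>u\<in>e. T > 0 \<and> reach_le G v u (T - 1)},
      (\<lambda>u. if reach_le G v u T then deg G u else 0))"

text \<open>A deterministic LOCAL algorithm with running time T(\<Delta>): the output of node v is an
  arbitrary function of n, \<Delta>, its own identifier, and its radius-T(\<Delta>) view.\<close>
type_synonym algorithm = "nat \<Rightarrow> nat \<Rightarrow> view \<Rightarrow> nat \<Rightarrow> nat"

definition run :: "algorithm \<Rightarrow> (nat \<Rightarrow> nat) \<Rightarrow> graph \<Rightarrow> nat \<Rightarrow> nat" where
  "run A T G v = A (card (fst G)) (max_deg G) (local_view G (T (max_deg G)) v) v"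

definition weak_2_coloring :: "graph \<Rightarrow> (nat \<Rightarrow> nat) \<Rightarrow> bool" where
  "weak_2_coloring G col \<longleftrightarrow>
     (\<forall>v\<in>fst G. col v \<in> {1, 2} \<and> (deg G v \<ge> 1 \<longrightarrow> (\<exists>u\<in>nbrs G v. col u \<noteq> col v)))"

text \<open>Admissible instances: simple connected graphs with identifiers in {1..n^c}
  (O(log n)-bit identifiers) in which every node has odd degree.\<close>
definition odd_instance :: "nat \<Rightarrow> graph \<Rightarrow> bool" where
  "odd_instance c G \<longleftrightarrow> simple_graph G \<and> connected_graph G \<and>
     fst G \<subseteq> {1 .. card (fst G) ^ c} \<and> (\<forall>v\<in>fst G. odd (deg G v))"

definition solves_weak2_odd :: "nat \<Rightarrow> algorithm \<Rightarrow> (nat \<Rightarrow> nat) \<Rightarrow> bool" where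
  "solves_weak2_odd c A T \<longleftrightarrow> (\<forall>G. odd_instance c G \<longrightarrow> weak_2_coloring G (run A T G))"

end

theory Submission
  imports Defs "HOL-Library.Ramsey"
begin

text \<open>Let \<open>\<Delta> = 2 m + 1\<close>. By Ramsey's theorem, for large \<open>n\<close> there is a set of identifiers on which the
  output of a \<open>T\<close>-round algorithm depends only on their relative order. A \<open>\<Delta>\<close>-regular tree with port
  numbers in which every node has \<open>m + 1\<close> outgoing and \<open>m\<close> incoming ports carries a linear order that can
  be read off locally, so on such trees the identifiers can be discarded altogether.

  The remaining algorithms are treated by round elimination. In a superweak \<open>k\<close>-coloring every node
  chooses one of \<open>k\<close> colors, some demanding ports and fewer, and at most \<open>k\<close>, accepting ports; a demanding
  port must lead to a node of a different color or to an accepting port. A weak 2-coloring yields a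
  superweak 2-coloring in one more round. From \<open>t + 1\<close> rounds and \<open>k\<close> colors one gets to \<open>t\<close> rounds and a
  number of colors that is seven exponentials larger, and zero rounds are impossible for \<open>k < m\<close>.
  Hence \<open>T\<close> is at least a constant times \<open>log\<^sup>* \<Delta>\<close>.\<close>

subsection \<open>Matchings\<close>

text \<open>The strict inequality \<open>card (A x) < card (D x)\<close> drives the round
  elimination. Suppose the ports of a node could be paired so that paired ports have compatible
  types. Giving the two ports of a pair swapped values would make every color as often blocked as
  demanded, whereas the color of the node must be demanded at more ports than it is blocked. So such
  a pairing fails, and Hall's theorem turns the failure into a set of types with too few partners;
  this set is the new color. The obstacle is that a perfect pairing cannot be hoped for, since
  frequent types leave ports over. These are harmless: a color that occurs there is blocked at more
  than \<open>k\<close> ports, while at most \<open>k\<close> ports accept. On the other side, the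
  algorithm knows \<open>n\<close> and the identifiers come from a bounded range, so the set
  provided by Ramsey's theorem has to be placed in a graph with exactly \<open>n\<close> nodes. The
  truncated tree is therefore padded with pairs of leaves, which keeps all degrees odd.\<close>

lemma hall_marriage:
  fixes N :: "'a \<Rightarrow> 'b set"
  assumes "finite X" "\<And>x. x \<in> X \<Longrightarrow> finite (N x)"
    and "\<And>S. S \<subseteq> X \<Longrightarrow> card S \<le> card (\<Union>x\<in>S. N x)"
  shows "\<exists>f. inj_on f X \<and> (\<forall>x\<in>X. f x \<in> N x)"
  using assms
proof (induction "card X" arbitrary: X N rule: less_induct)
  case less
  note fin = less.prems(1) and finN = less.prems(2) and hall = less.prems(3)
  show ?case
  proof (cases "X = {}")
    case True
    then show ?thesis by auto
  next
    case ne: False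
    show ?thesis
    \<comment> \<open>A proper nonempty tight \<open>S\<close> is matched inside its neighborhood
      \<open>U\<close> and the rest outside \<open>U\<close>. Without a tight set there is slack,
      and an arbitrary pair \<open>(x, y)\<close> can be split off.\<close>
    proof (cases "\<exists>S. S \<subset> X \<and> S \<noteq> {} \<and> card (\<Union>x\<in>S. N x) \<le> card S")
      case True
      then obtain S where S: "S \<subset> X" "S \<noteq> {}" and tight: "card (\<Union>x\<in>S. N x) \<le> card S" by blast
      define U where "U = (\<Union>x\<in>S. N x)"
      have finS: "finite S"
        using S fin by (auto intro: finite_subset)
      have "card S < card X" using S fin psubset_card_mono by blast
      then have "\<exists>f. inj_on f S \<and> (\<forall>x\<in>S. f x \<in> N x)"
        using S by (intro less.hyps finS finN hall) auto
      then obtain f where f: "inj_on f S" "\<forall>x\<in>S. f x \<in> N x" by blast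
      have "card (X - S) < card X"
        using S fin by (intro psubset_card_mono) auto
      moreover have "card S' \<le> card (\<Union>x\<in>S'. N x - U)" if "S' \<subseteq> X - S" for S'
      proof -
        have finS': "finite S'" using that fin finite_subset by blast
        have "card S' + card S = card (S' \<union> S)"
          using that finS finS' by (subst card_Un_disjoint) auto
        also have "\<dots> \<le> card (\<Union>x\<in>S' \<union> S. N x)" using that S by (intro hall) auto
        also have "(\<Union>x\<in>S' \<union> S. N x) = (\<Union>x\<in>S'. N x - U) \<union> U"
            unfolding U_def by auto
        also have "card \<dots> \<le> card (\<Union>x\<in>S'. N x - U) + card U" by (rule card_Un_le)
        finally show ?thesis using tight unfolding U_def by linarith
      qed
      ultimately have "\<exists>g. inj_on g (X - S) \<and> (\<forall>x\<in>X - S. g x \<in> N x - U)"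
        using fin finN by (intro less.hyps) simp_all
      then obtain g where g: "inj_on g (X - S)" "\<forall>x\<in>X - S. g x \<in> N x - U" by blast
      let ?h = "\<lambda>x. if x \<in> S then f x else g x"
      have "f ` S \<inter> g ` (X - S) = {}"
        using f(2) g(2) unfolding U_def by fastforce
      then have "inj_on ?h (S \<union> (X - S))"
        using f(1) g(1) by (intro inj_on_disjoint_Un)
      then have "inj_on ?h X"
        using S(1) by (simp add: Un_absorb1 psubset_imp_subset)
      moreover have "\<forall>x\<in>X. ?h x \<in> N x" using f(2) g(2) by simp
      ultimately show ?thesis by blast
    next
      case False
      then have slack: "card S < card (\<Union>x\<in>S. N x)" if "S \<subset> X" "S \<noteq> {}" for S
        using that by (auto simp: not_le)
      obtain x where x: "x \<in> X" using ne by auto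
      have "card {x} \<le> card (N x)" using hall[of "{x}"] x by simp
      then obtain y where y: "y \<in> N x" by fastforce
      have "card (X - {x}) < card X" using x fin by (meson card_Diff1_less)
      moreover have "card S \<le> card (\<Union>z\<in>S. N z - {y})" if "S \<subseteq> X - {x}" for S
      proof (cases "S = {}")
        case False
        have "card S < card (\<Union>z\<in>S. N z)" using slack that False x by blast
        moreover have "(\<Union>z\<in>S. N z - {y}) = (\<Union>z\<in>S. N z) - {y}" by auto
        moreover have "card (\<Union>z\<in>S. N z) \<le> Suc (card ((\<Union>z\<in>S. N z) - {y}))"
          by (simp add: card_Diff_singleton_if) arith
        ultimately show ?thesis by simp
      qed simp
      ultimately have "\<exists>f. inj_on f (X - {x}) \<and> (\<forall>z\<in>X - {x}. f z \<in> N z - {y})"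
        using fin finN by (intro less.hyps) simp_all
      then obtain f where f: "inj_on f (X - {x})" "\<forall>z\<in>X - {x}. f z \<in> N z - {y}" by blast
      have "inj_on (f(x := y)) X" using f by (auto simp: inj_on_def)
      moreover have "\<forall>z\<in>X. (f(x := y)) z \<in> N z" using f y by auto
      ultimately show ?thesis by blast
    qed
  qed
qed

text \<open>The Mendelsohn-Dulmage theorem, by the fixed point of the Schroeder-Bernstein proof:
  elements of \<open>X\<close> outside \<open>Z\<close> keep their \<open>f\<close>-partner, and
  \<open>g\<close> serves exactly those \<open>y\<close> not reached in this way, whose images form
  \<open>Z\<close>. It saturates both sides of a bipartite graph at once.\<close>

lemma merge_partial_matchings:
  assumes f: "inj_on f X" and g: "inj_on g Y"
  shows "\<exists>M. M \<subseteq> {(x, f x) |x. x \<in> X} \<union> {(g y, y) |y. y \<in> Y} \<and> inj_on fst M \<and> inj_on snd M \<and>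
    X \<subseteq> fst ` M \<and> Y \<subseteq> snd ` M"
proof -
  define \<Phi> where "\<Phi> S = g ` (Y - f ` (X - S))" for S
  have "mono \<Phi>" unfolding \<Phi>_def by (rule monoI) blast
  then obtain Z where Z: "Z = g ` (Y - f ` (X - Z))"
    using lfp_unfold[of \<Phi>] unfolding \<Phi>_def by blast
  define W where "W = f ` (X - Z)"
  define M where "M = {(x, f x) |x. x \<in> X - Z} \<union> {(g y, y) |y. y \<in> Y - W}"
  have ZW: "Z = g ` (Y - W)" using Z W_def by simp
  have fstM: "p = q" if "p \<in> M" "q \<in> M" "fst p = fst q" for p q
  proof -
    have "snd r = f (fst r) \<and> fst r \<notin> Z \<or> fst r \<in> Z \<and> snd r \<in> Y \<and> fst r = g (snd r)" if "r \<in> M" for r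
      using that ZW unfolding M_def by force
    from this[OF that(1)] this[OF that(2)] show ?thesis
      using that(3) inj_onD[OF g] by (auto simp: prod_eq_iff)
  qed
  have sndM: "p = q" if "p \<in> M" "q \<in> M" "snd p = snd q" for p q
  proof -
    have "fst r = g (snd r) \<and> snd r \<notin> W \<or> snd r \<in> W \<and> fst r \<in> X \<and> snd r = f (fst r)" if "r \<in> M" for r
      using that W_def unfolding M_def by force
    from this[OF that(1)] this[OF that(2)] show ?thesis
      using that(3) inj_onD[OF f] by (auto simp: prod_eq_iff)
  qed
  have "inj_on fst M" using fstM by (rule inj_onI)
  moreover have "inj_on snd M" using sndM by (rule inj_onI)
  moreover have "X \<subseteq> fst ` M"
  proof
    fix x assume "x \<in> X"
    then show "x \<in> fst ` M" unfolding M_def using ZW by (cases "x \<in> Z") force+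
  qed
  moreover have "Y \<subseteq> snd ` M"
  proof
    fix y assume "y \<in> Y"
    then show "y \<in> snd ` M" unfolding M_def using W_def by (cases "y \<in> W") force+
  qed
  moreover have "M \<subseteq> {(x, f x) |x. x \<in> X} \<union> {(g y, y) |y. y \<in> Y}"
      unfolding M_def by blast
  ultimately show ?thesis by blast
qed

text \<open>Pigeonhole: the half-open intervals from \<open>thr j\<close> to
  \<open>thr (Suc j)\<close> with \<open>j \<le> card Ty\<close> are disjoint, and there is one more
  of them than elements of \<open>Ty\<close>.\<close>

lemma gap_in_thresholds:
  fixes cnt :: "'a \<Rightarrow> nat" and thr :: "nat \<Rightarrow> nat"
  assumes "finite Ty" "mono thr"
  shows "\<exists>j \<le> card Ty. \<forall>Q\<in>Ty. cnt Q \<le> thr j \<or> thr (Suc j) < cnt Q"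
proof (rule ccontr)
  assume "\<not> ?thesis"
  then have "\<forall>j\<in>{..card Ty}. \<exists>Q\<in>Ty. thr j < cnt Q \<and> cnt Q \<le> thr (Suc j)"
    by (meson atMost_iff not_le)
  then obtain q where q: "\<And>j. j \<le> card Ty \<Longrightarrow> q j \<in> Ty \<and> thr j < cnt (q j) \<and> cnt (q j) \<le> thr (Suc j)"
    by (metis atMost_iff)
  have "q i \<noteq> q j" if "i < j" "j \<le> card Ty" for i j
    using q[of i] q[of j] that monoD[OF assms(2), of "Suc i" j] by force
  then have "inj_on q {..card Ty}"
    by (intro linorder_inj_onI) auto
  then have "card {..card Ty} \<le> card Ty"
    using q assms(1) by (metis atMost_iff card_inj_on_le image_subsetI)
  then show False by simp
qed

subsection \<open>Deficient sets of port types\<close>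

text \<open>The direction of the edge at the port, and the pairs (demanded colors, blocked colors)
  that the edge may still turn out to have. The two ends see the same pair with its components
  swapped. The direction makes compatibility a bipartite relation.\<close>

type_synonym ptype = "bool \<times> (nat set \<times> nat set) set"

definition compatible :: "ptype \<Rightarrow> ptype \<Rightarrow> bool" where
  "compatible Q Q' \<longleftrightarrow> fst Q \<noteq> fst Q' \<and> (\<exists>a b. (a, b) \<in> snd Q \<and> (b, a) \<in> snd Q')"

lemma compatible_sym: "compatible Q Q' \<Longrightarrow> compatible Q' Q"
  unfolding compatible_def by metis

definition ports_of :: "nat set \<Rightarrow> (nat \<Rightarrow> ptype) \<Rightarrow> ptype set \<Rightarrow> nat set" where
  "ports_of P ty X = {p\<in>P. ty p \<in> X}"

definition nbr_ports :: "nat set \<Rightarrow> (nat \<Rightarrow> ptype) \<Rightarrow> ptype set \<Rightarrow> nat set" where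
  "nbr_ports P ty X = {p\<in>P. \<exists>Q\<in>X. compatible Q (ty p)}"

text \<open>The two ports of a pair receive swapped values, so their contributions cancel. Every color that
  occurs in the value of an unpaired port occurs on the second side of more than \<open>k\<close> ports, because the
  pairs of types \<open>Q\<close> and \<open>par Q\<close> receive the same value as the unpaired ports of type \<open>Q\<close>.\<close>

lemma selection_from_pairs:
  fixes ty :: "nat \<Rightarrow> ptype"
  assumes P: "finite P" and E: "E \<subseteq> P \<times> P" "inj_on fst E" "inj_on snd E"
      "fst ` E \<inter> snd ` E = {}"
    and Ecmpt: "\<And>p q. (p, q) \<in> E \<Longrightarrow> compatible (ty p) (ty q)"
    and par: "\<And>Q. Q \<in> Fr \<Longrightarrow> compatible Q (par Q)"
    and rest: "\<And>p. p \<in> P \<Longrightarrow> p \<notin> fst ` E \<Longrightarrow> p \<notin> snd ` E \<Longrightarrow> ty p \<in> Fr"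
    and many: "\<And>Q. Q \<in> Fr \<Longrightarrow> k < card {e\<in>E. ty (fst e) = Q \<and> ty (snd e) = par Q}"
  shows "\<exists>s. (\<forall>p\<in>P. s p \<in> snd (ty p)) \<and>
    (\<forall>c. card {p\<in>P. c \<in> fst (s p)} \<le> card {p\<in>P. c \<in> snd (s p)} \<or> k < card {p\<in>P. c \<in> snd (s p)})"
proof -
  \<comment> \<open>The choice depends on the two types only, so the pairs counted in
    \<open>many\<close> share their value with the unpaired ports of type \<open>Q\<close>.\<close>
  define w where "w Q Q' = (SOME ab. ab \<in> snd Q \<and> prod.swap ab \<in> snd Q')" for Q Q' :: ptype
  have w: "w Q Q' \<in> snd Q" "prod.swap (w Q Q') \<in> snd Q'" if c: "compatible Q Q'" for Q Q'
  proof -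
    obtain a b where "(a, b) \<in> snd Q" "(b, a) \<in> snd Q'"
      using c unfolding compatible_def by blast
    then have "\<exists>ab. ab \<in> snd Q \<and> prod.swap ab \<in> snd Q'"
      by (intro exI[of _ "(a, b)"]) simp
    then have "w Q Q' \<in> snd Q \<and> prod.swap (w Q Q') \<in> snd Q'"
      unfolding w_def by (rule someI_ex)
    then show "w Q Q' \<in> snd Q" "prod.swap (w Q Q') \<in> snd Q'" by auto
  qed
  define l where "l = the_inv_into E fst"
  define r where "r = the_inv_into E snd"
  have l: "l (fst e) = e" if "e \<in> E" for e
    unfolding l_def using that E(2) by (simp add: the_inv_into_f_f)
  have r: "r (snd e) = e" if "e \<in> E" for e
    unfolding r_def using that E(3) by (simp add: the_inv_into_f_f)
  define we where "we e = w (ty (fst e)) (ty (snd e))" for e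
  define s where "s p = (if p \<in> fst ` E then we (l p) else if p \<in> snd ` E then prod.swap (we (r p))
     else w (ty p) (par (ty p)))" for p
  have s1: "s (fst e) = we e" if "e \<in> E" for e
    unfolding s_def using that l by simp
  have s2: "s (snd e) = prod.swap (we e)" if "e \<in> E" for e
  proof -
    have "snd e \<notin> fst ` E" using E(4) that by blast
    then show ?thesis unfolding s_def using that r by simp
  qed
  have s3: "s p = w (ty p) (par (ty p))" if "p \<notin> fst ` E" "p \<notin> snd ` E" for p
    unfolding s_def using that by simp
  have finE: "finite E" using E(1) P finite_subset by blast
  have "s p \<in> snd (ty p)" if p: "p \<in> P" for p
  proof -
    consider e where "e \<in> E" "p = fst e" | e where "e \<in> E" "p = snd e" | "p \<notin> fst ` E"
        "p \<notin> snd ` E"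
      by (metis imageE)
    then show ?thesis
    proof cases
      case 1
      then show ?thesis using s1 w(1) Ecmpt[of "fst e" "snd e"] we_def by simp
    next
      case 2
      then show ?thesis using s2 w(2) Ecmpt[of "fst e" "snd e"] we_def by simp
    next
      case 3
      then show ?thesis using s3 w(1) rest[OF p] par by simp
    qed
  qed
  moreover have "card {p\<in>P. c \<in> fst (s p)} \<le> card {p\<in>P. c \<in> snd (s p)} \<or> k < card {p\<in>P. c \<in> snd (s p)}" for c
  proof (cases "\<exists>Q\<in>Fr. c \<in> fst (w Q (par Q)) \<union> snd (w Q (par Q))")
    case True
    then obtain Q where Q: "Q \<in> Fr" "c \<in> fst (w Q (par Q)) \<or> c \<in> snd (w Q (par Q))" by blast
    let ?K = "{e\<in>E. ty (fst e) = Q \<and> ty (snd e) = par Q}"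
    have weK: "we e = w Q (par Q)" if "e \<in> ?K" for e using that we_def by auto
    from Q(2) have "card ?K \<le> card {p\<in>P. c \<in> snd (s p)}"
    proof
      assume c: "c \<in> fst (w Q (par Q))"
      have "card ?K = card (snd ` ?K)"
        using inj_on_subset[OF E(3)] by (intro card_image[symmetric]) auto
      also have "\<dots> \<le> card {p\<in>P. c \<in> snd (s p)}"
        using P E(1) s2 weK c by (intro card_mono) auto
      finally show ?thesis .
    next
      assume c: "c \<in> snd (w Q (par Q))"
      have "card ?K = card (fst ` ?K)"
        using inj_on_subset[OF E(2)] by (intro card_image[symmetric]) auto
      also have "\<dots> \<le> card {p\<in>P. c \<in> snd (s p)}"
        using P E(1) s1 weK c by (intro card_mono) auto
      finally show ?thesis .
    qed
    then show ?thesis using many[OF Q(1)] by linarith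
  next
    case False
    have inE: "p \<in> fst ` E \<union> snd ` E" if "p \<in> P" "c \<in> fst (s p) \<union> snd (s p)" for p
    proof (rule ccontr)
      assume "p \<notin> fst ` E \<union> snd ` E"
      then have "s p = w (ty p) (par (ty p))" "ty p \<in> Fr" using s3 rest that by auto
      then show False using that(2) False by auto
    qed
    have eq1: "{p\<in>P. c \<in> fst (s p)} = fst ` {e\<in>E. c \<in> fst (we e)} \<union>
        snd ` {e\<in>E. c \<in> snd (we e)}" (is "?A = ?B")
    proof (intro subset_antisym subsetI)
      fix p assume p: "p \<in> ?A"
      then consider e where "e \<in> E" "p = fst e" | e where "e \<in> E" "p = snd e"
        using inE[of p] by (metis (mono_tags, lifting) Un_iff imageE mem_Collect_eq)
      then show "p \<in> ?B"
      proof cases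
        case 1
        then have "e \<in> {e\<in>E. c \<in> fst (we e)}" using p s1 by simp
        then show ?thesis using 1(2) by blast
      next
        case 2
        then have "e \<in> {e\<in>E. c \<in> snd (we e)}" using p s2 by simp
        then show ?thesis using 2(2) by blast
      qed
    next
      fix p assume "p \<in> ?B"
      then show "p \<in> ?A" using E(1) s1 s2 by auto
    qed
    have eq2: "{p\<in>P. c \<in> snd (s p)} = fst ` {e\<in>E. c \<in> snd (we e)} \<union>
        snd ` {e\<in>E. c \<in> fst (we e)}" (is "?A = ?B")
    proof (intro subset_antisym subsetI)
      fix p assume p: "p \<in> ?A"
      then consider e where "e \<in> E" "p = fst e" | e where "e \<in> E" "p = snd e"
        using inE[of p] by (metis (mono_tags, lifting) Un_iff imageE mem_Collect_eq)
      then show "p \<in> ?B"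
      proof cases
        case 1
        then have "e \<in> {e\<in>E. c \<in> snd (we e)}" using p s1 by simp
        then show ?thesis using 1(2) by blast
      next
        case 2
        then have "e \<in> {e\<in>E. c \<in> fst (we e)}" using p s2 by simp
        then show ?thesis using 2(2) by blast
      qed
    next
      fix p assume "p \<in> ?B"
      then show "p \<in> ?A" using E(1) s1 s2 by auto
    qed
    have "card (fst ` X \<union> snd ` Y) = card X + card Y" if "X \<subseteq> E" "Y \<subseteq> E" for X Y
    proof -
      have "finite X" "finite Y" using that finE finite_subset by auto
      moreover have "fst ` X \<inter> snd ` Y = {}" using that E(4) by blast
      ultimately have "card (fst ` X \<union> snd ` Y) = card (fst ` X) + card (snd ` Y)"
        by (intro card_Un_disjoint) auto
      then show ?thesis
        using that E(2,3) by (simp add: card_image inj_on_subset)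
    qed
    then show ?thesis unfolding eq1 eq2 by simp
  qed
  ultimately show ?thesis by blast
qed

text \<open>Types are split at a gap between two consecutive thresholds: the frequent types then have more
  ports than all infrequent types together, with room for \<open>2 * Suc k\<close> extra ports per type.\<close>

fun threshold :: "nat \<Rightarrow> nat \<Rightarrow> nat \<Rightarrow> nat" where
  "threshold N k 0 = 0"
| "threshold N k (Suc j) = N * threshold N k j + 2 * N * Suc k"

definition accept_bound :: "nat \<Rightarrow> nat \<Rightarrow> nat" where
  "accept_bound N k = N * threshold N k N"

lemma threshold_mono:
  assumes "N \<ge> 1"
  shows "mono (threshold N k)"
proof (rule incseq_SucI)
  fix j
  have "threshold N k j \<le> N * threshold N k j" using assms by simp
  then show "threshold N k j \<le> threshold N k (Suc j)"
    unfolding threshold.simps by (rule trans_le_add1)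
qed

lemma card_fibres_le:
  assumes "finite Ty" "f ` J \<subseteq> Ty" "\<And>Q. Q \<in> Ty \<Longrightarrow> card {p\<in>J. f p = Q} \<le> t" "finite J"
  shows "card J \<le> card Ty * t"
proof -
  have "J = (\<Union>Q\<in>Ty. {p\<in>J. f p = Q})" using assms(2) by auto
  then have "card J = card (\<Union>Q\<in>Ty. {p\<in>J. f p = Q})" by simp
  also have "\<dots> \<le> (\<Sum>Q\<in>Ty. card {p\<in>J. f p = Q})"
    by (rule card_UN_le[OF assms(1)])
  also have "\<dots> \<le> card Ty * t" using sum_bounded_above[of Ty _ t] assms(3) by simp
  finally show ?thesis .
qed

text \<open>By contradiction: if no set is deficient, the ports are paired as
  \<open>selection_from_pairs\<close> requires, and the resulting selection refutes
  \<open>sel\<close>. Infrequent ports whose compatible types are all infrequent are matched inside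
  \<open>J\<close>, the remaining ports of \<open>J\<close> receive partners of frequent type where
  needed, and \<open>k + 1\<close> pairs are reserved for each frequent type.\<close>

lemma deficient_type_set:
  fixes ty :: "nat \<Rightarrow> ptype"
  assumes P: "finite P" and Ty: "finite Ty" "ty ` P \<subseteq> Ty" "card Ty = N" "N \<ge> 1"
    and sel: "\<And>s. (\<And>p. p \<in> P \<Longrightarrow> s p \<in> snd (ty p)) \<Longrightarrow>
       \<exists>c. card {p\<in>P. c \<in> snd (s p)} < card {p\<in>P. c \<in> fst (s p)} \<and> card {p\<in>P. c \<in> snd (s p)} \<le> k"
  shows "\<exists>X\<subseteq>Ty. card (nbr_ports P ty X) < card (ports_of P ty X) \<and> card (nbr_ports P ty X) \<le> accept_bound N k"
proof (rule ccontr)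
  assume "\<not> ?thesis"
  then have H: "card (ports_of P ty X) \<le> card (nbr_ports P ty X)"
    if "X \<subseteq> Ty" "card (nbr_ports P ty X) \<le> accept_bound N k" for X
    using that by (meson not_le)
  define cnt where "cnt Q = card {p\<in>P. ty p = Q}" for Q
  obtain j where j: "j \<le> N" "\<And>Q. Q \<in> Ty \<Longrightarrow> cnt Q \<le> threshold N k j \<or> threshold N k (Suc j) < cnt Q"
    using gap_in_thresholds[OF Ty(1) threshold_mono[OF Ty(4)], of cnt k] Ty(3) by blast
  define t where "t = threshold N k j"
  define Fr where "Fr = {Q\<in>Ty. N * t + 2 * N * Suc k < cnt Q}"
  define J where "J = {p\<in>P. ty p \<notin> Fr}"
  have finJ: "finite J" and finFr: "finite Fr" using P Ty unfolding J_def Fr_def by auto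
  have cntJ: "cnt (ty p) \<le> t" if "p \<in> J" for p
    using that j(2)[of "ty p"] Ty(2) unfolding J_def Fr_def t_def by auto
  have cardJ: "card J \<le> N * t"
    unfolding Ty(3)[symmetric]
  proof (rule card_fibres_le[OF Ty(1) _ _ finJ, of ty])
    show "ty ` J \<subseteq> Ty" using Ty(2) J_def by auto
    fix Q
    show "card {p \<in> J. ty p = Q} \<le> t"
    proof (cases "{p \<in> J. ty p = Q} = {}")
      case False
      then obtain p where "p \<in> J" "ty p = Q" by blast
      then have "cnt Q \<le> t" using cntJ by blast
      moreover have "card {p \<in> J. ty p = Q} \<le> cnt Q"
        unfolding cnt_def J_def using P by (intro card_mono) auto
      ultimately show ?thesis by linarith
    next
      case True
      then show ?thesis by (simp only: card.empty)
    qed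
  qed
  have "t \<le> threshold N k N"
    unfolding t_def using monoD[OF threshold_mono[OF Ty(4)] j(1)] .
  then have Jbound: "card J \<le> accept_bound N k"
    using cardJ unfolding accept_bound_def by (meson le_trans mult_le_mono2)
  \<comment> \<open>A neighborhood inside \<open>J\<close> has at most
    \<open>accept_bound N k\<close> ports, so \<open>H\<close> applies.\<close>
  have infr: "card (ports_of P ty X) \<le> card (nbr_ports P ty X)"
    if "X \<subseteq> Ty" "nbr_ports P ty X \<subseteq> J" for X
    using H that Jbound card_mono[OF finJ that(2)] by (meson le_trans)
  \<comment> \<open>Otherwise the neighbors of the more than \<open>N * t\<close> ports of type
    \<open>Q\<close> would all lie in \<open>J\<close>, which has at most \<open>N * t\<close>
    elements.\<close>
  have "\<exists>Q'\<in>Fr. compatible Q Q'" if Q: "Q \<in> Fr" for Q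
  proof (rule ccontr)
    assume "\<not> ?thesis"
    then have sub: "nbr_ports P ty {Q} \<subseteq> J" unfolding nbr_ports_def J_def by blast
    have "card (ports_of P ty {Q}) \<le> card J"
      using infr[of "{Q}"] sub Q card_mono[OF finJ sub] unfolding Fr_def by fastforce
    then show False using Q cardJ unfolding Fr_def cnt_def ports_of_def by simp
  qed
  then obtain par where par: "\<And>Q. Q \<in> Fr \<Longrightarrow> par Q \<in> Fr \<and> compatible Q (par Q)" by metis
  define J1 where "J1 = {p\<in>J. \<forall>Q\<in>Fr. \<not> compatible (ty p) Q}"
  define nb where "nb x = {p\<in>P. compatible (ty x) (ty p)}" for x
  have nbJ: "nb x \<subseteq> J" if "x \<in> J1" for x
    using that unfolding nb_def J1_def J_def by blast
  have "\<exists>h. inj_on h J1 \<and> (\<forall>x\<in>J1. h x \<in> nb x)"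
  proof (rule hall_marriage)
    show "finite J1" unfolding J1_def using finJ by simp
    show "finite (nb x)" for x unfolding nb_def using P by simp
    fix S assume S: "S \<subseteq> J1"
    \<comment> \<open>Adding all ports whose type occurs in \<open>S\<close> leaves the neighborhood
      unchanged, so the inequality for sets of types yields Hall's condition for sets of
      ports.\<close>
    have eq: "nbr_ports P ty (ty ` S) = (\<Union>x\<in>S. nb x)" unfolding nbr_ports_def nb_def by auto
    have SP: "S \<subseteq> P" using S unfolding J1_def J_def by auto
    have subJ: "nbr_ports P ty (ty ` S) \<subseteq> J"
      unfolding eq using S nbJ by blast
    have "card S \<le> card (ports_of P ty (ty ` S))"
      using P SP unfolding ports_of_def by (intro card_mono) auto
    also have "\<dots> \<le> card (nbr_ports P ty (ty ` S))"
      using SP Ty(2) subJ by (intro infr) auto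
    finally show "card S \<le> card (\<Union>x\<in>S. nb x)" unfolding eq .
  qed
  then obtain h where h: "inj_on h J1" "\<And>x. x \<in> J1 \<Longrightarrow> h x \<in> nb x" by blast
  \<comment> \<open>\<open>h\<close> may send a port of \<open>J1\<close> to another port of
    \<open>J1\<close> that has a different partner itself. Splitting by direction and merging gives
    a genuine matching that still covers \<open>J1\<close>.\<close>
  define L where "L = {x\<in>J1. fst (ty x)}"
  define R where "R = {x\<in>J1. \<not> fst (ty x)}"
  have "inj_on h L" "inj_on h R" using h(1) unfolding L_def R_def by (auto intro: inj_on_subset)
  from merge_partial_matchings[OF this] obtain M
    where M: "M \<subseteq> {(x, h x) |x. x \<in> L} \<union> {(h y, y) |y. y \<in> R}" "inj_on fst M"
        "inj_on snd M"
      "L \<subseteq> fst ` M" "R \<subseteq> snd ` M" by blast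
  have Mprop: "compatible (ty x) (ty y) \<and> x \<in> J \<and> y \<in> J \<and> fst (ty x) \<and> \<not> fst (ty y)" if "(x, y) \<in> M" for x y
  proof -
    have hJ: "h z \<in> J" "compatible (ty z) (ty (h z))" "z \<in> J" if "z \<in> J1" for z
      using nbJ[OF that] h(2)[OF that] that unfolding nb_def J1_def by auto
    have "x \<in> L \<and> y = h x \<or> y \<in> R \<and> x = h y" using that M(1) by blast
    then show ?thesis
      using hJ compatible_sym unfolding L_def R_def by (auto simp: compatible_def)
  qed
  define U where "U = J - (fst ` M \<union> snd ` M)"
  have "\<exists>Q\<in>Fr. compatible (ty p) Q" if "p \<in> U" for p
  proof (rule ccontr)
    assume "\<not> ?thesis"
    then have "p \<in> L \<union> R" using that unfolding U_def L_def R_def J1_def by auto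
    then show False using that M(4,5) unfolding U_def by blast
  qed
  then obtain fq where fq: "\<And>p. p \<in> U \<Longrightarrow> fq p \<in> Fr \<and> compatible (ty p) (fq p)" by metis
  \<comment> \<open>Requests for ports of frequent type: \<open>Inl p\<close> asks for the partner
    of \<open>p\<close>; \<open>Inr (Q, i, True)\<close> and \<open>Inr (Q, i, False)\<close> ask
    for the two ports of the \<open>i\<close>-th reserved pair of \<open>Q\<close> with
    \<open>par Q\<close>.\<close>
  define Dm where "Dm = (Inl ` U \<union> Inr ` (Fr \<times> {..k} \<times> UNIV) :: (nat + ptype \<times> nat \<times> bool) set)"
  define dty where "dty d = (case d of Inl p \<Rightarrow> fq p | Inr (Q, i, b) \<Rightarrow> if b then Q else par Q)"
      for d :: "nat + ptype \<times> nat \<times> bool"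
  have finU: "finite U" unfolding U_def using finJ by simp
  have finDm: "finite Dm" unfolding Dm_def using finU finFr by simp
  have dtyFr: "dty d \<in> Fr" if "d \<in> Dm" for d
    using that fq par unfolding Dm_def dty_def by auto
  have cardDm: "card Dm \<le> N * t + 2 * N * Suc k"
  proof -
    have "card Dm \<le>
        card (Inl ` U :: (nat + ptype \<times> nat \<times> bool) set) + card (Inr ` (Fr \<times> {..k} \<times> UNIV) :: (nat + ptype \<times> nat \<times> bool) set)"
      unfolding Dm_def by (rule card_Un_le)
    also have "\<dots> = card U + card Fr * (Suc k * 2)"
      by (simp add: card_image card_cartesian_product)
    finally have "card Dm \<le> card U + card Fr * (Suc k * 2)" .
    moreover have "card U \<le> N * t"
      using cardJ card_mono[OF finJ, of U] unfolding U_def by auto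
    moreover have "card Fr \<le> N"
      using card_mono[OF Ty(1), of Fr] Ty(3) unfolding Fr_def by auto
    then have "card Fr * (Suc k * 2) \<le> N * (Suc k * 2)" by (rule mult_le_mono1)
    moreover have "N * (Suc k * 2) = 2 * N * Suc k" by simp
    ultimately show ?thesis by linarith
  qed
  \<comment> \<open>Hall's condition is immediate, because every single request has more than
    \<open>card Dm\<close> candidates.\<close>
  have "\<exists>i. inj_on i Dm \<and> (\<forall>d\<in>Dm. i d \<in> {p\<in>P. ty p = dty d})"
  proof (rule hall_marriage[OF finDm])
    show "finite {p\<in>P. ty p = dty d}" for d using P by simp
    fix S assume S: "S \<subseteq> Dm"
    show "card S \<le> card (\<Union>d\<in>S. {p\<in>P. ty p = dty d})"
    proof (cases "S = {}")
      case False
      then obtain d where d: "d \<in> S" by blast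
      have "card S \<le> N * t + 2 * N * Suc k" using card_mono[OF finDm S] cardDm by linarith
      also have "\<dots> \<le> cnt (dty d)" using dtyFr[of d] d S unfolding Fr_def by auto
      also have "\<dots> \<le> card (\<Union>d\<in>S. {p\<in>P. ty p = dty d})"
        unfolding cnt_def using d P finite_subset[OF S finDm] by (intro card_mono) auto
      finally show ?thesis .
    qed simp
  qed
  then obtain i where i: "inj_on i Dm" "\<And>d. d \<in> Dm \<Longrightarrow> i d \<in> P \<and> ty (i d) = dty d" by blast
  have iJ: "i d \<notin> J" if "d \<in> Dm" for d
    using i(2)[OF that] dtyFr[OF that] unfolding J_def by auto
  define Fk where "Fk = Fr \<times> {..k}"
  define e1 where "e1 u = (u, i (Inl u))" for u
  define e2 where "e2 z = (i (Inr (fst z, snd z, True)), i (Inr (fst z, snd z, False)))" for z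
  define E where "E = M \<union> e1 ` U \<union> e2 ` Fk"
  have DmU: "Inl u \<in> Dm" if "u \<in> U" for u using that unfolding Dm_def by blast
  have DmF: "Inr (fst z, snd z, b) \<in> Dm" if "z \<in> Fk" for z b using that unfolding Dm_def Fk_def by auto
  have ieq: "i d = i d' \<longleftrightarrow> d = d'" if "d \<in> Dm" "d' \<in> Dm" for d d'
    using inj_on_eq_iff[OF i(1)] that by blast
  have MJ: "fst e \<in> J" "snd e \<in> J" if "e \<in> M" for e
    using Mprop[of "fst e" "snd e"] that by auto
  have UJ: "u \<in> J" "u \<notin> fst ` M" "u \<notin> snd ` M" if "u \<in> U" for u using that
      unfolding U_def by auto
  have 1: "E \<subseteq> P \<times> P"
  proof -
    have "M \<subseteq> P \<times> P" using Mprop unfolding J_def by auto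
    moreover have "e1 ` U \<subseteq> P \<times> P" using UJ(1) i(2)[OF DmU] unfolding e1_def J_def by auto
    moreover have "e2 ` Fk \<subseteq> P \<times> P" using i(2)[OF DmF] unfolding e2_def by auto
    ultimately show ?thesis unfolding E_def by blast
  qed
  have inj_Un: "inj_on f (A \<union> B)" if "inj_on f A" "inj_on f B" "f ` A \<inter> f ` B = {}"
    for f :: "nat \<times> nat \<Rightarrow> nat" and A B
    using that by (auto simp: inj_on_Un)
  have e2_inj: "z = z'" if "i (Inr (fst z, snd z, b)) = i (Inr (fst z', snd z', b))" "z \<in> Fk"
      "z' \<in> Fk" for z z' b
    using that ieq[OF DmF DmF] by (simp add: prod_eq_iff)
  have 2: "inj_on fst E"
    unfolding E_def
  proof (intro inj_Un M(2))
    show "inj_on fst (e1 ` U)" by (auto simp: inj_on_def e1_def)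
    show "inj_on fst (e2 ` Fk)"
    proof (rule inj_onI, elim imageE)
      fix x y z z' assume *: "fst x = fst y" "x = e2 z" "z \<in> Fk" "y = e2 z'" "z' \<in> Fk"
      then have "z = z'" using e2_inj[of z True z'] by (simp add: e2_def)
      then show "x = y" using * by simp
    qed
    have "fst ` e1 ` U = U" by (simp add: e1_def image_image)
    then show "fst ` M \<inter> fst ` e1 ` U = {}" using UJ(2) by blast
    have "fst ` (M \<union> e1 ` U) \<subseteq> J" using MJ UJ(1) by (auto simp: e1_def)
    moreover have "fst ` e2 ` Fk \<inter> J = {}" using iJ[OF DmF] by (auto simp: e2_def)
    ultimately show "fst ` (M \<union> e1 ` U) \<inter> fst ` e2 ` Fk = {}" by blast
  qed
  have 3: "inj_on snd E"
    unfolding E_def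
  proof (intro inj_Un M(3))
    show "inj_on snd (e1 ` U)"
    proof (rule inj_onI, elim imageE)
      fix x y z z' assume *: "snd x = snd y" "x = e1 z" "z \<in> U" "y = e1 z'" "z' \<in> U"
      then have "z = z'" using ieq[OF DmU DmU] by (simp add: e1_def)
      then show "x = y" using * by simp
    qed
    show "inj_on snd (e2 ` Fk)"
    proof (rule inj_onI, elim imageE)
      fix x y z z' assume *: "snd x = snd y" "x = e2 z" "z \<in> Fk" "y = e2 z'" "z' \<in> Fk"
      then have "z = z'" using e2_inj[of z False z'] by (simp add: e2_def)
      then show "x = y" using * by simp
    qed
    have MJ': "snd ` M \<subseteq> J" using MJ by blast
    moreover have U': "snd ` e1 ` U \<inter> J = {}" using iJ[OF DmU] by (auto simp: e1_def)
    ultimately show "snd ` M \<inter> snd ` e1 ` U = {}" by blast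
    have "snd ` e2 ` Fk \<inter> J = {}" using iJ[OF DmF] by (auto simp: e2_def)
    moreover have "snd ` e2 ` Fk \<inter> snd ` e1 ` U = {}"
    proof (rule ccontr)
      assume "\<not> ?thesis"
      then obtain z u where "z \<in> Fk" "u \<in> U" "i (Inr (fst z, snd z, False)) = i (Inl u)"
        by (auto simp: e1_def e2_def)
      then show False using ieq[OF DmF DmU] by simp
    qed
    ultimately show "snd ` (M \<union> e1 ` U) \<inter> snd ` e2 ` Fk = {}" using MJ' by blast
  qed
  have 4: "fst ` E \<inter> snd ` E = {}"
  proof -
    have a: "x \<in> J \<and> fst (ty x) \<and> x \<in> fst ` M \<or> x \<in> U \<or>
        (\<exists>z\<in>Fk. x = i (Inr (fst z, snd z, True)))" if "x \<in> fst ` E" for x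
    proof -
      from that consider e where "e \<in> M" "x = fst e" | "x \<in> U" | z where "z \<in> Fk" "x =
          i (Inr (fst z, snd z, True))"
        unfolding E_def e1_def e2_def by auto
      then show ?thesis
      proof cases
        case 1
        then have "x \<in> fst ` M" by blast
        then show ?thesis using Mprop[of "fst e" "snd e"] 1 by simp
      qed blast+
    qed
    have b: "x \<in> J \<and> \<not> fst (ty x) \<and> x \<in> snd ` M \<or> (\<exists>u\<in>U. x =
        i (Inl u)) \<or> (\<exists>z\<in>Fk. x = i (Inr (fst z, snd z, False)))" if "x \<in> snd ` E" for x
    proof -
      from that consider e where "e \<in> M" "x = snd e" | u where "u \<in> U" "x = i (Inl u)" | z where
          "z \<in> Fk" "x = i (Inr (fst z, snd z, False))"
        unfolding E_def e1_def e2_def by auto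
      then show ?thesis
      proof cases
        case 1
        then have "x \<in> snd ` M" by blast
        then show ?thesis using Mprop[of "fst e" "snd e"] 1 by simp
      qed blast+
    qed
    show ?thesis
    proof (rule ccontr)
      assume "\<not> ?thesis"
      then obtain x where x: "x \<in> fst ` E" "x \<in> snd ` E" by blast
      show False
      proof (cases "x \<in> J")
        case True
        then have "x \<notin> i ` Dm" using iJ by blast
        then have "x \<in> fst ` M \<and> fst (ty x) \<or> x \<in> U" "x \<in> snd ` M \<and> \<not> fst (ty x)"
          using a[OF x(1)] b[OF x(2)] DmU DmF by blast+
        then show False using UJ(3) by blast
      next
        case False
        then obtain z where z: "z \<in> Fk" "x = i (Inr (fst z, snd z, True))" using a[OF x(1)] UJ(1) by blast
        from False consider u where "u \<in> U" "x = i (Inl u)" | z where "z \<in> Fk" "x =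
            i (Inr (fst z, snd z, False))"
          using b[OF x(2)] by blast
        then show False
          using z ieq[OF DmF DmF] ieq[OF DmU DmF] by cases simp_all
      qed
    qed
  qed
  have "\<exists>s. (\<forall>p\<in>P. s p \<in> snd (ty p)) \<and>
    (\<forall>c. card {p\<in>P. c \<in> fst (s p)} \<le> card {p\<in>P. c \<in> snd (s p)} \<or> k < card {p\<in>P. c \<in> snd (s p)})"
  proof (rule selection_from_pairs[OF P 1 2 3 4])
    show "compatible (ty p) (ty q)" if "(p, q) \<in> E" for p q
    proof -
      have "(p, q) \<in> M \<or> p \<in> U \<and> q = i (Inl p) \<or> (\<exists>z\<in>Fk. p =
          i (Inr (fst z, snd z, True)) \<and> q = i (Inr (fst z, snd z, False)))"
        using that unfolding E_def e1_def e2_def by auto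
      then show ?thesis
      proof (elim disjE conjE bexE)
        assume "(p, q) \<in> M" then show ?thesis using Mprop by blast
      next
        assume "p \<in> U" "q = i (Inl p)"
        then show ?thesis using fq i(2)[OF DmU] by (simp add: dty_def)
      next
        fix z assume "z \<in> Fk" "p = i (Inr (fst z, snd z, True))" "q = i (Inr (fst z, snd z, False))"
        then show ?thesis using par i(2)[OF DmF] by (auto simp: dty_def Fk_def)
      qed
    qed
    show "compatible Q (par Q)" if "Q \<in> Fr" for Q using par that by blast
    show "ty p \<in> Fr" if "p \<in> P" "p \<notin> fst ` E" "p \<notin> snd ` E" for p
    proof (rule ccontr)
      assume "ty p \<notin> Fr"
      then have "p \<in> J" using that(1) unfolding J_def by simp
      then have "p \<in> fst ` M \<union> snd ` M \<union> U" unfolding U_def by blast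
      moreover have "U \<subseteq> fst ` E" unfolding E_def e1_def by force
      ultimately show False using that(2,3) unfolding E_def by blast
    qed
    show "k < card {e\<in>E. ty (fst e) = Q \<and> ty (snd e) = par Q}" if Q: "Q \<in> Fr" for Q
    proof -
      let ?g = "\<lambda>l. e2 (Q, l)"
      have Fk: "(Q, l) \<in> Fk" if "l \<le> k" for l using Q that unfolding Fk_def by simp
      have "inj_on ?g {..k}"
      proof (rule inj_onI)
        fix x y assume xy: "x \<in> {..k}" "y \<in> {..k}" "?g x = ?g y"
        then have "i (Inr (Q, x, True)) = i (Inr (Q, y, True))" unfolding e2_def by simp
        then show "x = y" using ieq DmF[OF Fk[of x]] DmF[OF Fk[of y]] xy by simp
      qed
      moreover have "?g ` {..k} \<subseteq> {e\<in>E. ty (fst e) = Q \<and> ty (snd e) = par Q}"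
      proof
        fix e assume "e \<in> ?g ` {..k}"
        then obtain l where l: "l \<le> k" "e = e2 (Q, l)" by auto
        then have "e \<in> E" unfolding E_def using Fk by blast
        then show "e \<in> {e\<in>E. ty (fst e) = Q \<and> ty (snd e) = par Q}"
          using l i(2)[OF DmF[OF Fk[OF l(1)]]] unfolding e2_def dty_def by simp
      qed
      moreover have "finite {e\<in>E. ty (fst e) = Q \<and> ty (snd e) = par Q}"
        using finite_subset[OF 1] P by simp
      ultimately have "card {..k} \<le> card {e\<in>E. ty (fst e) = Q \<and> ty (snd e) = par Q}"
        by (rule card_inj_on_le)
      then show ?thesis by simp
    qed
  qed
  then obtain s where s: "\<And>p. p \<in> P \<Longrightarrow> s p \<in> snd (ty p)"
    "\<And>c. card {p\<in>P. c \<in> fst (s p)} \<le> card {p\<in>P. c \<in> snd (s p)} \<or> k < card {p\<in>P. c \<in> snd (s p)}" by blast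
  obtain c where "card {p\<in>P. c \<in> snd (s p)} < card {p\<in>P. c \<in> fst (s p)}"
      "card {p\<in>P. c \<in> snd (s p)} \<le> k"
    using sel[of s] s(1) by blast
  then show False using s(2)[of c] by linarith
qed

subsection \<open>Port-numbered trees\<close>

text \<open>A tree is described from one of its nodes. The address of another node is the list of the ports
  taken on the way to it, and the tree maps this address to the port by which the node is entered.
  A branch stores its own entry port at \<open>[]\<close>; a whole tree stores there the non-port \<open>port_count\<close>.
  Addresses that walk back along an edge are mapped to \<open>0\<close>.\<close>

type_synonym ptree = "nat list \<Rightarrow> nat"

definition sub :: "ptree \<Rightarrow> nat \<Rightarrow> ptree" where
  "sub y p = (\<lambda>a. y (p # a))"

definition graft :: "ptree \<Rightarrow> nat \<Rightarrow> ptree \<Rightarrow> ptree" where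
  "graft y p z = (\<lambda>a. case a of [] \<Rightarrow> y [] | r # b \<Rightarrow> if r = p then z b else y a)"

definition agree :: "nat \<Rightarrow> ptree \<Rightarrow> ptree \<Rightarrow> bool" where
  "agree t x y \<longleftrightarrow> (\<forall>a. length a \<le> t \<longrightarrow> x a = y a)"

lemma sub_apply [simp]: "sub y p a = y (p # a)"
  by (simp add: sub_def)

lemma graft_Nil [simp]: "graft y p z [] = y []"
  by (simp add: graft_def)

lemma graft_Cons [simp]: "graft y p z (r # b) = (if r = p then z b else y (r # b))"
  by (simp add: graft_def)

lemma sub_graft [simp]: "sub (graft y p z) r = (if r = p then z else sub y r)"
  by (auto simp: fun_eq_iff)

lemma ptree_eqI: "x [] = y [] \<Longrightarrow> (\<And>p. sub x p = sub y p) \<Longrightarrow> x = y"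
proof
  fix a
  assume "x [] = y []" "\<And>p. sub x p = sub y p"
  then show "x a = y a" by (cases a) (simp_all flip: sub_apply)
qed

lemma agree_refl [simp]: "agree t x x"
  by (simp add: agree_def)

lemma agree_sym: "agree t x y \<Longrightarrow> agree t y x"
  by (simp add: agree_def)

lemma agree_trans: "agree t x y \<Longrightarrow> agree t y z \<Longrightarrow> agree t x z"
  by (simp add: agree_def)

lemma agree_0 [simp]: "agree 0 x y \<longleftrightarrow> x [] = y []"
  by (simp add: agree_def)

lemma agree_mono: "agree t x y \<Longrightarrow> s \<le> t \<Longrightarrow> agree s x y"
  by (simp add: agree_def)

lemma agree_Suc: "agree (Suc t) x y \<longleftrightarrow> x [] = y [] \<and> (\<forall>p. agree t (sub x p) (sub y p))"
proof
  assume R: "x [] = y [] \<and> (\<forall>p. agree t (sub x p) (sub y p))"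
  have "x a = y a" if "length a \<le> Suc t" for a
    using that R by (cases a) (auto simp: agree_def)
  then show "agree (Suc t) x y" by (simp add: agree_def)
qed (auto simp: agree_def)

locale ported_trees =
  fixes m :: nat
begin

definition port_count :: nat where "port_count = 2 * m + 1"

text \<open>Edges are oriented: the ports \<open>p \<le> m\<close> are outgoing, the others are incoming.\<close>

definition opposite :: "nat \<Rightarrow> nat \<Rightarrow> bool" where
  "opposite p q \<longleftrightarrow> p < port_count \<and> q < port_count \<and> (p \<le> m) \<noteq> (q \<le> m)"

lemma opposite_sym: "opposite p q \<Longrightarrow> opposite q p"
  by (auto simp: opposite_def)

lemma opposite_less: "opposite p q \<Longrightarrow> p < port_count" "opposite p q \<Longrightarrow> q < port_count"
  by (auto simp: opposite_def)

text \<open>Walks without backtracking: \<open>y []\<close> is the port that leads back. In a whole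
  tree it is \<open>port_count\<close>, which excludes no port at the root.\<close>

fun reduced :: "ptree \<Rightarrow> nat list \<Rightarrow> bool" where
  "reduced y [] = True"
| "reduced y (p # a) = (p < port_count \<and> p \<noteq> y [] \<and> reduced (sub y p) a)"

text \<open>Trees are infinite, so validity is a condition on all addresses;
  \<open>valid_branch_iff\<close> is its one-step unfolding. Fixing the value \<open>0\<close> off
  the reduced addresses lets \<open>reroot_reroot\<close> hold as an equation.\<close>

definition valid_branch :: "ptree \<Rightarrow> bool" where
  "valid_branch y \<longleftrightarrow> (\<forall>a. (reduced y a \<longrightarrow> a \<noteq> [] \<longrightarrow> opposite (last a) (y a)) \<and> (\<not> reduced y a \<longrightarrow> y a = 0))"

lemma valid_branch_iff:
  "valid_branch y \<longleftrightarrow> (\<forall>p. if p < port_count \<and>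
      p \<noteq> y [] then opposite p (y [p]) \<and> valid_branch (sub y p) else sub y p = (\<lambda>_. 0))"
  (is "_ \<longleftrightarrow> ?R")
proof
  assume y: "valid_branch y"
  show ?R
  proof
    fix p
    show "if p < port_count \<and> p \<noteq> y [] then opposite p (y [p]) \<and>
        valid_branch (sub y p) else sub y p = (\<lambda>_. 0)"
    proof (cases "p < port_count \<and> p \<noteq> y []")
      case True
      have "opposite p (y [p])" using y True unfolding valid_branch_def
          by (metis last.simps list.distinct(1) reduced.simps)
      moreover have "(reduced (sub y p) a \<longrightarrow> a \<noteq> [] \<longrightarrow>
          opposite (last a) (sub y p a)) \<and> (\<not> reduced (sub y p) a \<longrightarrow> sub y p a =
          0)" for a
        using y[unfolded valid_branch_def, rule_format, of "p # a"] True by auto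
      ultimately show ?thesis using True unfolding valid_branch_def by auto
    next
      case False
      then have "y (p # a) = 0" for a using y[unfolded valid_branch_def, rule_format, of "p # a"] by auto
      then show ?thesis using False by (auto simp: fun_eq_iff)
    qed
  qed
next
  assume R: ?R
  show "valid_branch y"
    unfolding valid_branch_def
  proof
    fix a
    show "(reduced y a \<longrightarrow> a \<noteq> [] \<longrightarrow> opposite (last a) (y a)) \<and> (\<not> reduced y a \<longrightarrow> y a = 0)"
    proof (cases a)
      case (Cons p b)
      show ?thesis
      proof (cases "p < port_count \<and> p \<noteq> y []")
        case True
        then have *: "opposite p (y [p])" "valid_branch (sub y p)" using R by auto
        show ?thesis
          using *(1) *(2)[unfolded valid_branch_def, rule_format, of b] True Cons by (cases "b = []") auto
      next
        case False
        then have "sub y p b = 0" using R by (metis (no_types, lifting))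
        then show ?thesis using False Cons by auto
      qed
    qed simp
  qed
qed

definition valid_tree :: "ptree \<Rightarrow> bool" where
  "valid_tree x \<longleftrightarrow> x [] = port_count \<and> valid_branch x"

lemma valid_tree_Nil: "valid_tree x \<Longrightarrow> x [] = port_count"
  by (simp add: valid_tree_def)

lemma valid_tree_iff:
  "valid_tree x \<longleftrightarrow> x [] = port_count \<and> (\<forall>p<port_count. opposite p (x [p]) \<and> valid_branch (sub x p)) \<and>
      (\<forall>p\<ge>port_count. sub x p = (\<lambda>_. 0))"
  unfolding valid_tree_def
  by (subst valid_branch_iff) (simp cong: conj_cong add: all_conj_distrib not_less)

lemma valid_tree_opposite: "valid_tree x \<Longrightarrow> p < port_count \<Longrightarrow> opposite p (x [p])"
  by (simp add: valid_tree_iff)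

text \<open>What the neighbor at port \<open>p\<close> sees through the edge back: \<open>x\<close>
  without its branch at \<open>p\<close>, entered by port \<open>p\<close>.\<close>

definition cut :: "ptree \<Rightarrow> nat \<Rightarrow> ptree" where
  "cut x p = graft (x([] := p)) p (\<lambda>_. 0)"

text \<open>The same tree described from the neighbor at port \<open>p\<close>; the old root hangs
  at the neighbor's port \<open>x [p]\<close>.\<close>

definition reroot :: "ptree \<Rightarrow> nat \<Rightarrow> ptree" where
  "reroot x p = graft ((sub x p)([] := port_count)) (x [p]) (cut x p)"

lemma cut_Nil [simp]: "cut x p [] = p"
  by (simp add: cut_def)

lemma sub_cut: "sub (cut x p) r = (if r = p then (\<lambda>_. 0) else sub x r)"
  by (auto simp: cut_def fun_eq_iff)

lemma cut_Cons [simp]: "cut x p (r # a) = (if r = p then 0 else x (r # a))"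
  by (simp add: cut_def)

lemma reroot_Nil [simp]: "reroot x p [] = port_count"
  by (simp add: reroot_def)

lemma reroot_Cons: "reroot x p (r # a) = (if r = x [p] then cut x p a else x (p # r # a))"
  by (simp add: reroot_def)

lemma sub_reroot: "sub (reroot x p) r = (if r = x [p] then cut x p else sub (sub x p) r)"
  by (auto simp: fun_eq_iff reroot_Cons)

lemma reroot_back [simp]: "reroot x p [x [p]] = p"
  by (simp add: reroot_Cons)

lemma valid_branch_cut:
  assumes "valid_tree x" "p < port_count"
  shows "valid_branch (cut x p)"
  unfolding valid_branch_iff[of "cut x p"]
proof
  fix r
  show "if r < port_count \<and> r \<noteq> cut x p [] then opposite r (cut x p [r]) \<and>
      valid_branch (sub (cut x p) r) else sub (cut x p) r = (\<lambda>_. 0)"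
    using assms unfolding valid_tree_iff by (simp add: sub_cut)
qed

lemma valid_tree_reroot:
  assumes x: "valid_tree x" and p: "p < port_count"
  shows "valid_tree (reroot x p)"
proof -
  have s: "valid_branch (sub x p)" "opposite p (x [p])" using x p unfolding valid_tree_iff by auto
  have sr: "if r < port_count \<and> r \<noteq> x [p] then opposite r (x [p, r]) \<and>
      valid_branch (sub (sub x p) r) else sub (sub x p) r = (\<lambda>_. 0)" for r
    using s(1)[unfolded valid_branch_iff[of "sub x p"], rule_format, of r] by (auto split: if_splits)
  show ?thesis
    unfolding valid_tree_iff
  proof (intro conjI allI impI)
    fix r assume r: "r < port_count"
    show "opposite r (reroot x p [r])"
      using s(2) sr[of r] r by (auto simp: reroot_Cons opposite_sym)
    show "valid_branch (sub (reroot x p) r)"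
      using valid_branch_cut[OF x p] sr[of r] r by (auto simp: sub_reroot)
  next
    fix r assume r: "port_count \<le> r"
    then show "sub (reroot x p) r = (\<lambda>_. 0)"
      using opposite_less(2)[OF s(2)] sr[of r] by (auto simp: sub_reroot)
  qed simp
qed

lemma reroot_reroot:
  assumes x: "valid_tree x" and p: "p < port_count"
  shows "reroot (reroot x p) (x [p]) = x"
proof (rule ptree_eqI)
  show "reroot (reroot x p) (x [p]) [] = x []" using valid_tree_Nil[OF x] by simp
  have s: "valid_branch (sub x p)" using x p unfolding valid_tree_iff by auto
  then have z: "sub (sub x p) (x [p]) = (\<lambda>_. 0)"
    unfolding valid_branch_iff[of "sub x p"] by (auto dest: spec[of _ "x [p]"])
  fix r
  show "sub (reroot (reroot x p) (x [p])) r = sub x r"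
  proof (cases "r = p")
    case True
    have "cut (reroot x p) (x [p]) = sub x p"
    proof (rule ptree_eqI)
      show "sub (cut (reroot x p) (x [p])) q = sub (sub x p) q" for q
        using z by (auto simp: sub_cut sub_reroot)
    qed simp
    then show ?thesis using True by (simp add: sub_reroot)
  next
    case False
    then show ?thesis by (simp add: sub_reroot sub_cut)
  qed
qed

text \<open>Agreement on the radius-\<open>t\<close> neighborhoods of both endpoints of the edge at port \<open>p\<close> of the root.\<close>

definition edge_agree :: "nat \<Rightarrow> nat \<Rightarrow> ptree \<Rightarrow> ptree \<Rightarrow> bool" where
  "edge_agree t p x y \<longleftrightarrow> agree t x y \<and> agree t (sub x p) (sub y p)"

lemma edge_agree_sym: "edge_agree t p x y \<Longrightarrow> edge_agree t p y x"
  by (auto simp: edge_agree_def agree_sym)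

lemma edge_agree_trans: "edge_agree t p x y \<Longrightarrow> edge_agree t p y z \<Longrightarrow> edge_agree t p x z"
  by (auto simp: edge_agree_def intro: agree_trans)

lemma edge_agree_port: "edge_agree t p x y \<Longrightarrow> x [p] = y [p]"
  unfolding edge_agree_def agree_def by (metis le0 list.size(3) sub_apply)

lemma agree_cut: "agree t x y \<Longrightarrow> agree t (cut x p) (cut y p)"
  unfolding agree_def
proof (intro allI impI)
  fix a :: "nat list" assume "\<forall>a. length a \<le> t \<longrightarrow> x a = y a" "length a \<le> t"
  then show "cut x p a = cut y p a" by (cases a) auto
qed

lemma agree_reroot:
  assumes "edge_agree t p x y"
  shows "agree t (reroot x p) (reroot y p)"
  unfolding agree_def
proof (intro allI impI)
  fix a :: "nat list" assume a: "length a \<le> t"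
  show "reroot x p a = reroot y p a"
  proof (cases a)
    case (Cons r b)
    have "cut x p b = cut y p b"
      using agree_cut[of t x y p] assms a Cons by (auto simp: edge_agree_def agree_def)
    moreover have "x (p # r # b) = y (p # r # b)"
      using assms a Cons by (auto simp: edge_agree_def agree_def)
    ultimately show ?thesis using Cons edge_agree_port[OF assms] by (simp add: reroot_Cons)
  qed simp
qed

lemma edge_agree_reroot:
  assumes "edge_agree t p x y"
  shows "edge_agree t (x [p]) (reroot x p) (reroot y p)"
proof -
  have "agree t (cut x p) (cut y p)" using assms by (simp add: edge_agree_def agree_cut)
  then show ?thesis
    using agree_reroot[OF assms] edge_agree_port[OF assms] by (simp add: edge_agree_def sub_reroot)
qed

lemma agree_reroot_Suc:
  assumes "agree (Suc t) x y"
  shows "agree t (reroot x p) (reroot y p)"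
proof (rule agree_reroot)
  show "edge_agree t p x y"
    using assms agree_mono[OF assms, of t] unfolding edge_agree_def agree_Suc by simp
qed

text \<open>An inhabitant, used to realize any prescribed entry port behind a port of the root. An
  outgoing port leads to entry port \<open>2 * m\<close>, an incoming one to \<open>0\<close>; for
  \<open>0 < m\<close> these are opposite.\<close>

fun default_branch :: "nat \<Rightarrow> nat list \<Rightarrow> nat" where
  "default_branch q [] = q"
| "default_branch q (p # a) = (if p < port_count \<and> p \<noteq> q then default_branch (if p \<le>
    m then 2 * m else 0) a else 0)"

lemma valid_branch_default_branch:
  assumes "0 < m"
  shows "valid_branch (default_branch q)"
proof -
  have "(reduced (default_branch q) a \<longrightarrow> a \<noteq> [] \<longrightarrow> opposite (last a) (default_branch q a)) \<and>
      (\<not> reduced (default_branch q) a \<longrightarrow> default_branch q a = 0)" for a q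
  proof (induction a arbitrary: q)
    case (Cons p a)
    let ?o = "if p \<le> m then 2 * m else 0"
    show ?case
    proof (cases "p < port_count \<and> p \<noteq> q")
      case True
      then have "sub (default_branch q) p = default_branch ?o"
        by (simp add: sub_def)
      moreover have "opposite p ?o"
        using True assms by (auto simp: opposite_def port_count_def)
      ultimately show ?thesis
        using Cons.IH[of ?o] True by (cases "a = []") simp_all
    next
      case False
      then show ?thesis by auto
    qed
  qed simp
  then show ?thesis unfolding valid_branch_def by blast
qed

lemma ex_valid_tree:
  assumes "0 < m" "opposite p q"
  shows "\<exists>x. valid_tree x \<and> x [p] = q"
proof -
  have "valid_tree (default_branch port_count)"
    unfolding valid_tree_def using valid_branch_default_branch[OF assms(1)] by simp
  then have "valid_tree (graft (default_branch port_count) p (default_branch q))"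
    using valid_branch_default_branch[OF assms(1), of q] opposite_less[OF assms(2)] assms(2)
        unfolding valid_tree_iff by auto
  then show ?thesis by (intro exI[of _ "graft (default_branch port_count) p (default_branch q)"]) simp
qed


subsection \<open>Superweak colorings and round elimination\<close>

text \<open>The output of the root consists of a color, the set \<open>D\<close> of its demanding ports and the set \<open>A\<close> of
  its accepting ports; it is determined by the radius-\<open>t\<close> neighborhood.\<close>

definition superweak ::
  "nat \<Rightarrow> nat \<Rightarrow> (ptree \<Rightarrow> nat) \<Rightarrow> (ptree \<Rightarrow> nat set) \<Rightarrow> (ptree \<Rightarrow> nat set) \<Rightarrow> bool" where
  "superweak t k col D A \<longleftrightarrow>
     (\<forall>x y. valid_tree x \<longrightarrow> valid_tree y \<longrightarrow> agree t x y \<longrightarrow> col x = col y \<and> D x = D y \<and> A x = A y) \<and>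
     (\<forall>x. valid_tree x \<longrightarrow> col x < k \<and> D x \<subseteq> {..<port_count} \<and> A x \<subseteq> {..<port_count} \<and> card (A x) < card (D x) \<and> card (A x) \<le> k) \<and>
     (\<forall>x p. valid_tree x \<longrightarrow> p \<in> D x \<longrightarrow> col (reroot x p) \<noteq> col x \<or> x [p] \<in> A (reroot x p))"

lemma superweakD:
  assumes "superweak t k col D A"
  shows "valid_tree x \<Longrightarrow> valid_tree y \<Longrightarrow> agree t x y \<Longrightarrow> col x = col y"
    "valid_tree x \<Longrightarrow> valid_tree y \<Longrightarrow> agree t x y \<Longrightarrow> D x = D y"
    "valid_tree x \<Longrightarrow> valid_tree y \<Longrightarrow> agree t x y \<Longrightarrow> A x = A y"
    "valid_tree x \<Longrightarrow> col x < k" "valid_tree x \<Longrightarrow> D x \<subseteq> {..<port_count}" "valid_tree x \<Longrightarrow> A x \<subseteq> {..<port_count}"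
    "valid_tree x \<Longrightarrow> card (A x) < card (D x)" "valid_tree x \<Longrightarrow> card (A x) \<le> k"
    "valid_tree x \<Longrightarrow> p \<in> D x \<Longrightarrow> col (reroot x p) = col x \<Longrightarrow> x [p] \<in> A (reroot x p)"
  using assms unfolding superweak_def by blast+

text \<open>At radius 0 all valid trees look alike, so \<open>col\<close>, \<open>D\<close> and
  \<open>A\<close> are constant and a demand at \<open>p\<close> never meets a different color. The
  neighbor may be entered by each of the at least \<open>m\<close> ports opposite to
  \<open>p\<close>; all of them would have to accept, but at most \<open>k\<close> do.\<close>

lemma no_superweak_0:
  assumes "0 < m" "k < m"
  shows "\<not> superweak 0 k col D A"
proof
  assume S: "superweak 0 k col D A"
  note S = superweakD[OF S]
  have ag: "agree 0 x y" if "valid_tree x" "valid_tree y" for x y using that by (simp add: valid_tree_def)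
  have "opposite 0 (2 * m)" using assms by (auto simp: opposite_def port_count_def)
  then obtain x0 where x0: "valid_tree x0" using ex_valid_tree assms(1) by blast
  have "D x0 \<noteq> {}" using S(7)[OF x0] by auto
  then obtain p where p: "p \<in> D x0" by blast
  have pD: "p < port_count" using p S(5)[OF x0] by auto
  have "{q. opposite p q} \<subseteq> A x0"
  proof
    fix q assume "q \<in> {q. opposite p q}"
    then obtain x where x: "valid_tree x" "x [p] = q" using ex_valid_tree assms(1) by blast
    have r: "valid_tree (reroot x p)" using valid_tree_reroot x(1) pD by blast
    have "p \<in> D x" using S(2)[OF x(1) x0 ag] x(1) x0 p by simp
    moreover have "col (reroot x p) = col x" using S(1)[OF r x(1) ag] r x(1) by simp
    ultimately have "q \<in> A (reroot x p)" using S(9)[OF x(1)] x(2) by blast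
    then show "q \<in> A x0" using S(3)[OF r x0 ag] r x0 by simp
  qed
  moreover have "finite (A x0)" using S(6)[OF x0] finite_subset by blast
  ultimately have "card {q. opposite p q} \<le> card (A x0)" by (rule card_mono[rotated])
  moreover have "m \<le> card {q. opposite p q}"
  proof (cases "p \<le> m")
    case True
    then have "{q. opposite p q} = {m<..<port_count}" using pD by (auto simp: opposite_def)
    then show ?thesis by (simp add: port_count_def)
  next
    case False
    then have "{q. opposite p q} = {..m}" using pD by (auto simp: opposite_def port_count_def)
    then show ?thesis by simp
  qed
  ultimately show False using S(8)[OF x0] assms(2) by linarith
qed

end

section \<open>One step of round elimination\<close>

locale speedup = ported_trees +
  fixes t k :: nat and col :: "ptree \<Rightarrow> nat" and D A :: "ptree \<Rightarrow> nat set"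
  assumes S: "superweak (Suc t) k col D A"
begin

text \<open>Given the edge view of radius \<open>t\<close>, these are the colors with which the node, respectively its
  neighbor, may still demand along the edge. If the node takes a blocked color it must accept.\<close>

definition demand_colors :: "ptree \<Rightarrow> nat \<Rightarrow> nat set" where
  "demand_colors x p = {c. \<exists>y. valid_tree y \<and> edge_agree t p y x \<and> col y = c \<and> p \<in> D y}"

definition blocked_colors :: "ptree \<Rightarrow> nat \<Rightarrow> nat set" where
  "blocked_colors x p = demand_colors (reroot x p) (x [p])"

text \<open>\<open>y\<close> ranges over all continuations of the tree beyond radius
  \<open>t\<close>. The pair at \<open>p\<close> depends only on how the branch at \<open>p\<close>
  continues.\<close>

definition port_type :: "ptree \<Rightarrow> nat \<Rightarrow> ptype" where
  "port_type x p = (p \<le> m, {(demand_colors y p, blocked_colors y p) |y. valid_tree y \<and> agree t x y})"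

definition all_types :: "ptype set" where
  "all_types = UNIV \<times> Pow (Pow {..<k} \<times> Pow {..<k})"

lemma demand_colors_cong:
  assumes "edge_agree t p x y"
  shows "demand_colors x p = demand_colors y p"
proof -
  have "edge_agree t p z x \<longleftrightarrow> edge_agree t p z y" for z
    using assms edge_agree_trans edge_agree_sym by blast
  then show ?thesis unfolding demand_colors_def by simp
qed

lemma blocked_colors_cong:
  assumes "edge_agree t p x y"
  shows "blocked_colors x p = blocked_colors y p"
  using demand_colors_cong[OF edge_agree_reroot[OF assms]] edge_agree_port[OF assms]
      by (simp add: blocked_colors_def)

lemma demand_colors_subset: "demand_colors x p \<subseteq> {..<k}"
  using superweakD(4)[OF S] by (auto simp: demand_colors_def)

lemma blocked_colors_reroot:
  assumes "valid_tree x" "p < port_count"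
  shows "blocked_colors (reroot x p) (x [p]) = demand_colors x p"
  unfolding blocked_colors_def using reroot_reroot[OF assms] by simp

lemma finite_all_types: "finite all_types"
  unfolding all_types_def by simp

lemma card_all_types: "card all_types = 2 * 2 ^ (2 ^ k * 2 ^ k)"
  unfolding all_types_def by (simp add: card_cartesian_product card_Pow)

lemma port_type_in: "port_type x p \<in> all_types"
  using demand_colors_subset unfolding port_type_def all_types_def blocked_colors_def by auto

lemma port_type_cong:
  assumes "agree t x y"
  shows "port_type x = port_type y"
proof -
  have "agree t x z \<longleftrightarrow> agree t y z" for z
    using assms agree_trans agree_sym by blast
  then show ?thesis unfolding port_type_def by simp
qed

text \<open>The two sides of an edge can be continued independently. A neighbor \<open>z\<close>
  that demands with color \<open>col x\<close> is rerooted to this end as \<open>y\<close>, and the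
  branch of \<open>y\<close> at \<open>p\<close> is grafted onto \<open>x\<close>. The result
  \<open>w\<close> agrees with \<open>x\<close>, and \<open>reroot w p\<close> with
  \<open>z\<close>, up to radius \<open>t + 1\<close>; in \<open>w\<close> the demand meets an equal
  color, so \<open>p\<close> accepts.\<close>

lemma blocked_colors_imp_accept:
  assumes x: "valid_tree x" and p: "p < port_count" and c: "col x \<in> blocked_colors x p"
  shows "p \<in> A x"
proof -
  let ?q = "x [p]"
  have q: "?q < port_count" using valid_tree_opposite[OF x p] opposite_less by blast
  obtain z where z: "valid_tree z" "edge_agree t ?q z (reroot x p)" "col z = col x" "?q \<in> D z"
    using c unfolding blocked_colors_def demand_colors_def by blast
  define y where "y = reroot z ?q"
  have zq: "z [?q] = p" using edge_agree_port[OF z(2)] by simp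
  have y: "valid_tree y" unfolding y_def using valid_tree_reroot[OF z(1) q] .
  have yz: "reroot y p = z" unfolding y_def using reroot_reroot[OF z(1) q] zq by simp
  have yp: "y [p] = ?q" unfolding y_def using reroot_back[of z ?q] zq by simp
  have yx: "edge_agree t p y x"
    using edge_agree_reroot[OF z(2)] reroot_reroot[OF x p] zq unfolding y_def by simp
  define w where "w = graft x p (sub y p)"
  have w: "valid_tree w"
    using x y p yp valid_tree_opposite[OF x p] unfolding valid_tree_iff w_def by auto
  have wq: "w [p] = ?q" unfolding w_def using yp by simp
  have "agree (Suc t) w x"
    using yx unfolding agree_Suc w_def edge_agree_def by simp
  then have wx: "col w = col x" "A w = A x" using superweakD(1,3)[OF S w x] by auto
  have "agree t (cut w p) (cut x p)"
    by (simp add: w_def cut_def agree_def graft_def split: list.split)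
  moreover have "agree t (cut y p) (cut x p)" using yx agree_cut unfolding edge_agree_def by blast
  ultimately have cut: "agree t (cut w p) (cut y p)" using agree_trans agree_sym by blast
  have "agree (Suc t) (reroot w p) (reroot y p)"
    unfolding agree_Suc
  proof (intro conjI allI)
    fix r
    show "agree t (sub (reroot w p) r) (sub (reroot y p) r)"
      using cut wq yp by (simp add: sub_reroot) (simp add: w_def)
  qed simp
  then have "agree (Suc t) (reroot w p) z" using yz by simp
  then have wz: "col (reroot w p) = col z" "D (reroot w p) = D z"
    using superweakD(1,2)[OF S valid_tree_reroot[OF w p] z(1)] by auto
  have "?q \<in> D (reroot w p)" using wz z by simp
  moreover have "col (reroot (reroot w p) ?q) = col (reroot w p)"
    using reroot_reroot[OF w p] wq wz z wx by simp
  ultimately have "reroot w p [?q] \<in> A (reroot (reroot w p) ?q)"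
    using superweakD(9)[OF S valid_tree_reroot[OF w p]] by blast
  then show ?thesis using reroot_reroot[OF w p] wq wx reroot_back[of w p] by simp
qed

lemma demand_imp_demand_colors: "valid_tree x \<Longrightarrow> p \<in> D x \<Longrightarrow> col x \<in> demand_colors x p"
  unfolding demand_colors_def edge_agree_def by auto

text \<open>The hypothesis \<open>sel\<close> of \<open>deficient_type_set\<close> holds because any
  selection of possible pairs, one per port, is realized by a single tree \<open>w\<close>, glued
  from one branch per port. The color of \<open>w\<close> is demanded on at least
  \<open>card (D w)\<close> ports and blocked on at most \<open>card (A w)\<close>.\<close>

lemma ex_deficient:
  assumes x: "valid_tree x"
  shows "\<exists>X\<subseteq>all_types. card (nbr_ports {..<port_count} (port_type x) X) < card (ports_of {..<port_count} (port_type x) X) \<and>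
    card (nbr_ports {..<port_count} (port_type x) X) \<le> accept_bound (card all_types) k"
proof (rule deficient_type_set)
  show "port_type x ` {..<port_count} \<subseteq> all_types" using port_type_in by blast
  show "1 \<le> card all_types" by (simp add: card_all_types)
  fix s assume s: "\<And>p. p \<in> {..<port_count} \<Longrightarrow> s p \<in> snd (port_type x p)"
  have "\<forall>p\<in>{..<port_count}. \<exists>y. valid_tree y \<and> agree t x y \<and> s p = (demand_colors y p, blocked_colors y p)"
    using s unfolding port_type_def by fastforce
  then obtain y where y: "\<And>p. p < port_count \<Longrightarrow> valid_tree (y p) \<and>
      agree t x (y p) \<and> s p = (demand_colors (y p) p, blocked_colors (y p) p)"
    by (metis lessThan_iff)
  define w where "w = (\<lambda>a. case a of [] \<Rightarrow> port_count | p # b \<Rightarrow> if p < port_count then y p a else 0)"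
  have sw: "sub w p = (if p < port_count then sub (y p) p else (\<lambda>_. 0))" for p
    by (auto simp: w_def fun_eq_iff)
  have w: "valid_tree w"
    unfolding valid_tree_iff
  proof (intro conjI allI impI)
    fix p assume p: "p < port_count"
    then have "opposite p (y p [p]) \<and> valid_branch (sub (y p) p)" using y unfolding valid_tree_iff by blast
    moreover have "w [p] = y p [p]" using p by (simp add: w_def)
    ultimately show "opposite p (w [p])" "valid_branch (sub w p)" using p by (simp_all add: sw)
  qed (auto simp: sw, simp add: w_def)
  have wx: "agree t w x"
    unfolding agree_def
  proof (intro allI impI)
    fix a :: "nat list" assume a: "length a \<le> t"
    show "w a = x a"
    proof (cases a)
      case Nil
      then show ?thesis using valid_tree_Nil[OF x] by (simp add: w_def)
    next
      case (Cons p b)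
      show ?thesis
      proof (cases "p < port_count")
        case True
        then show ?thesis using y[OF True] a Cons by (simp add: w_def agree_def)
      next
        case False
        then have "sub x p b = 0" using x unfolding valid_tree_iff by (meson not_le)
        then show ?thesis using False Cons by (simp add: w_def)
      qed
    qed
  qed
  have eq: "s p = (demand_colors w p, blocked_colors w p)" if p: "p < port_count" for p
  proof -
    have "edge_agree t p w (y p)"
      unfolding edge_agree_def using y[OF p] agree_trans[OF wx] p by (simp add: sw)
    then show ?thesis using demand_colors_cong blocked_colors_cong y[OF p] by metis
  qed
  have "D w \<subseteq> {p\<in>{..<port_count}. col w \<in> fst (s p)}"
    using superweakD(5)[OF S w] demand_imp_demand_colors[OF w] eq by fastforce
  then have d: "card (D w) \<le> card {p\<in>{..<port_count}. col w \<in> fst (s p)}" by (intro card_mono) auto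
  have "{p\<in>{..<port_count}. col w \<in> snd (s p)} \<subseteq> A w"
    using blocked_colors_imp_accept[OF w] eq by auto
  moreover have "finite (A w)" using superweakD(6)[OF S w] finite_subset by blast
  ultimately have a: "card {p\<in>{..<port_count}. col w \<in> snd (s p)} \<le> card (A w)" by (intro card_mono)
  have "card {p\<in>{..<port_count}. col w \<in> snd (s p)} < card {p\<in>{..<port_count}. col w \<in> fst (s p)} \<and>
      card {p\<in>{..<port_count}. col w \<in> snd (s p)} \<le> k"
    using a d superweakD(7,8)[OF S w] by linarith
  then show "\<exists>c. card {p\<in>{..<port_count}. c \<in> snd (s p)} < card {p\<in>{..<port_count}. c \<in> fst (s p)} \<and>
      card {p\<in>{..<port_count}. c \<in> snd (s p)} \<le> k"
    by blast
qed (simp_all add: finite_all_types)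

text \<open>The pair that the edge has in \<open>x\<close> itself is a common witness, since
  blocking is demanding seen from the other end.\<close>

lemma compatible_across:
  assumes x: "valid_tree x" and p: "p < port_count"
  shows "compatible (port_type x p) (port_type (reroot x p) (x [p]))"
proof -
  have "fst (port_type x p) \<noteq> fst (port_type (reroot x p) (x [p]))"
    using valid_tree_opposite[OF x p] by (simp add: opposite_def port_type_def)
  moreover have "(demand_colors x p, blocked_colors x p) \<in> snd (port_type x p)"
    unfolding port_type_def using x by auto
  moreover have
      "(demand_colors (reroot x p) (x [p]), blocked_colors (reroot x p) (x [p])) \<in> snd (port_type (reroot x p) (x [p]))"
    unfolding port_type_def using valid_tree_reroot[OF x p] by auto
  then have "(blocked_colors x p, demand_colors x p) \<in> snd (port_type (reroot x p) (x [p]))"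
    unfolding blocked_colors_reroot[OF x p] blocked_colors_def[of x p] .
  ultimately show ?thesis unfolding compatible_def by blast
qed

text \<open>The new color of a node is a deficient set \<open>X\<close> of port types, its demanding ports are those with
  type in \<open>X\<close>, and its accepting ports those whose type is compatible with \<open>X\<close>. The types at the two ends
  of an edge are always compatible, so a demand between nodes of equal color is accepted.\<close>

lemma superweak_speedup:
  assumes "2 ^ card all_types \<le> k'" "accept_bound (card all_types) k \<le> k'"
  shows "\<exists>col' D' A'. superweak t k' col' D' A'"
proof -
  define good where "good ty X \<longleftrightarrow> X \<subseteq> all_types \<and> card (nbr_ports {..<port_count} ty X) < card (ports_of {..<port_count} ty X) \<and>
    card (nbr_ports {..<port_count} ty X) \<le> accept_bound (card all_types) k" for ty X
  \<comment> \<open>The choice sees \<open>x\<close> only through \<open>port_type x\<close>, hence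
    only up to radius \<open>t\<close>.\<close>
  define ch where "ch x = (SOME X. good (port_type x) X)" for x
  have ch: "good (port_type x) (ch x)" if "valid_tree x" for x
    unfolding ch_def using ex_deficient[OF that] unfolding good_def by (rule someI_ex)
  obtain enc :: "ptype set \<Rightarrow> nat" where enc:
      "bij_betw enc (Pow all_types) {0..<card (Pow all_types)}"
    using ex_bij_betw_finite_nat[of "Pow all_types"] finite_all_types by auto
  let ?D = "\<lambda>x. ports_of {..<port_count} (port_type x) (ch x)"
  let ?A = "\<lambda>x. nbr_ports {..<port_count} (port_type x) (ch x)"
  have "superweak t k' (\<lambda>x. enc (ch x)) ?D ?A"
    unfolding superweak_def
  proof (intro conjI allI impI)
    fix x y assume "agree t x y"
    then have "port_type x = port_type y" by (rule port_type_cong)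
    then show "enc (ch x) = enc (ch y)" "?D x = ?D y" "?A x = ?A y" unfolding ch_def by simp_all
  next
    fix x assume x: "valid_tree x"
    have "enc (ch x) \<in> {0..<card (Pow all_types)}"
      using bij_betwE[OF enc] ch[OF x] unfolding good_def by blast
    then show "enc (ch x) < k'" using assms(1) by (simp add: card_Pow finite_all_types)
    show "?D x \<subseteq> {..<port_count}" "?A x \<subseteq> {..<port_count}"
        by (auto simp: ports_of_def nbr_ports_def)
    show "card (?A x) < card (?D x)" "card (?A x) \<le> k'"
      using ch[OF x] assms(2) unfolding good_def by auto
  next
    fix x p assume x: "valid_tree x" and p: "p \<in> ?D x"
    have pD: "p < port_count" using p by (simp add: ports_of_def)
    have r: "valid_tree (reroot x p)" using valid_tree_reroot[OF x pD] .
    show "enc (ch (reroot x p)) \<noteq> enc (ch x) \<or> x [p] \<in> ?A (reroot x p)"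
    proof (cases "enc (ch (reroot x p)) = enc (ch x)")
      case True
      have "ch (reroot x p) = ch x"
        using ch[OF r] ch[OF x] True bij_betw_imp_inj_on[OF enc] unfolding good_def
        by (meson PowI inj_onD)
      then have "port_type x p \<in> ch (reroot x p)" using p by (simp add: ports_of_def)
      moreover have "x [p] < port_count" using valid_tree_opposite[OF x pD] opposite_less by blast
      ultimately show ?thesis
        using compatible_across[OF x pD] unfolding nbr_ports_def by blast
    qed simp
  qed
  then show ?thesis by blast
qed

end

subsection \<open>Tower bounds\<close>

primrec tower :: "nat \<Rightarrow> nat" where
  "tower 0 = 1"
| "tower (Suc n) = 2 ^ tower n"

lemma tower_pos: "1 \<le> tower n"
  by (induction n) auto

lemma strict_mono_tower: "strict_mono tower"
  by (simp add: strict_mono_Suc_iff)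

lemma threshold_le: "threshold N k j \<le> 2 * N * Suc k * Suc N ^ j"
proof (induction j)
  case (Suc j)
  have "N * threshold N k j + 2 * N * Suc k \<le> N * (2 * N * Suc k * Suc N ^ j) + 2 * N * Suc k * Suc N ^ j"
    by (intro add_mono mult_le_mono2 Suc.IH) simp
  also have "\<dots> = 2 * N * Suc k * Suc N ^ Suc j" by (simp add: algebra_simps)
  finally show ?case by simp
qed simp

text \<open>The bound passes through \<open>2 ^ (1 + 3 * N + N * N)\<close> and
  \<open>2 ^ 2 ^ (2 * N + 2)\<close>; the last exponent is at most \<open>2 ^ N\<close> from
  \<open>N = 3\<close> on.\<close>

lemma accept_bound_le:
  assumes "Suc k \<le> N" "3 \<le> N"
  shows "accept_bound N k \<le> 2 ^ 2 ^ 2 ^ N"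
proof -
  have N: "N + 1 \<le> 2 ^ N" by (induction N) auto
  have "accept_bound N k \<le> N * (2 * N * Suc k * Suc N ^ N)"
    unfolding accept_bound_def by (intro mult_le_mono2 threshold_le)
  also have "\<dots> \<le> 2 ^ N * (2 * 2 ^ N * 2 ^ N * (2 ^ N) ^ N)"
    using N assms(1) by (intro mult_le_mono power_mono) auto
  also have "\<dots> = 2 ^ (1 + 3 * N + N * N)"
    by (simp add: power_add power_mult algebra_simps power3_eq_cube)
  also have "1 + 3 * N + N * N \<le> (2 ^ (N + 1)) ^ 2"
  proof -
    have "1 + 3 * N + N * N \<le> (N + 2) ^ 2" by (simp add: power2_eq_square)
    also have "\<dots> \<le> (2 ^ (N + 1)) ^ 2" using N by (intro power_mono) auto
    finally show ?thesis .
  qed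
  also have "(2 ^ (N + 1)) ^ 2 = (2::nat) ^ (2 * N + 2)"
    by (simp add: power_mult[symmetric] algebra_simps)
  also have "2 * N + 2 \<le> 2 ^ N"
    using assms(2) by (induction N rule: dec_induct) auto
  finally show ?thesis by (simp add: power_increasing)
qed

lemma types_le_tower:
  fixes k :: nat
  assumes "1 \<le> k"
  shows "2 * 2 ^ (2 ^ k * 2 ^ k) \<le> (2::nat) ^ 2 ^ 2 ^ 2 ^ k"
proof -
  have k: "2 * k \<le> 2 ^ k"
    using assms by (induction k rule: dec_induct) auto
  have "(2::nat) ^ k * 2 ^ k = 2 ^ (2 * k)"
    by (simp add: mult_2 power_add)
  also have "\<dots> \<le> 2 ^ 2 ^ k" using k by (intro power_increasing) auto
  finally have "Suc (2 ^ k * 2 ^ k) \<le> Suc (2 ^ 2 ^ k)" by simp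
  also have "\<dots> \<le> 2 ^ 2 ^ 2 ^ k"
    by (simp add: Suc_leI)
  finally have "2 ^ Suc (2 ^ k * 2 ^ k) \<le> (2::nat) ^ 2 ^ 2 ^ 2 ^ k"
    by (intro power_increasing) auto
  then show ?thesis by simp
qed

context ported_trees
begin

text \<open>The 7 is 4 + 3: for \<open>k = tower h\<close> there are at most
  \<open>tower (h + 4)\<close> port types, and the bound on accepting ports lies three exponentials
  above that. The new colors are sets of types and cost only one exponential.\<close>

lemma superweak_step:
  assumes S: "superweak (Suc t) (tower h) col D A"
  shows "\<exists>col' D' A'. superweak t (tower (h + 7)) col' D' A'"
proof -
  define k where "k = tower h"
  interpret speedup m t k col D A using S by unfold_locales (simp add: k_def)
  have k1: "1 \<le> k" unfolding k_def by (rule tower_pos)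
  define N where "N = card all_types"
  have NE: "N = 2 * 2 ^ (2 ^ k * 2 ^ k)" unfolding N_def by (rule card_all_types)
  have N4: "N \<le> tower (h + 4)"
    unfolding NE using types_le_tower[OF k1] by (simp add: k_def eval_nat_numeral)
  have h7: "tower (h + 7) = 2 ^ 2 ^ 2 ^ tower (h + 4)" by (simp add: eval_nat_numeral)
  have "4 \<le> (2::nat) ^ k * 2 ^ k"
    using power_increasing[OF k1, of "2::nat"] mult_mono[of 2 "2 ^ k" 2 "(2::nat) ^ k"] by simp
  then have "2 ^ 4 \<le> (2::nat) ^ (2 ^ k * 2 ^ k)" by (intro power_increasing) auto
  then have N3: "3 \<le> N" unfolding NE by simp
  have "k < 2 ^ k" by simp
  also have "(2::nat) ^ k \<le> 2 ^ k * 2 ^ k" by simp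
  also have "(2::nat) ^ k * 2 ^ k < 2 ^ (2 ^ k * 2 ^ k)" by (rule less_exp)
  also have "\<dots> \<le> N" unfolding NE by simp
  finally have kN: "Suc k \<le> N" by simp
  have "accept_bound N k \<le> 2 ^ 2 ^ 2 ^ N" by (rule accept_bound_le[OF kN N3])
  also have "\<dots> \<le> tower (h + 7)" unfolding h7 using N4 by (intro power_increasing) auto
  finally have 2: "accept_bound N k \<le> tower (h + 7)" .
  have "2 ^ N \<le> (2::nat) ^ tower (h + 4)" using N4 by (intro power_increasing) auto
  also have "\<dots> = tower (h + 5)" by (simp add: eval_nat_numeral)
  also have "\<dots> \<le> tower (h + 7)" using strict_mono_tower by (simp add: strict_mono_less_eq)
  finally have 1: "2 ^ N \<le> tower (h + 7)" .
  show ?thesis using superweak_speedup 1 2 unfolding N_def by blast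
qed

lemma no_superweak:
  assumes "tower (h + 7 * t) < m"
  shows "\<not> superweak t (tower h) col D A"
  using assms
proof (induction t arbitrary: h col D A)
  case 0
  then show ?case using no_superweak_0[of "tower h"] by simp
next
  case (Suc t)
  show ?case
  proof
    assume "superweak (Suc t) (tower h) col D A"
    then obtain col' D' A' where "superweak t (tower (h + 7)) col' D' A'"
      using superweak_step by blast
    moreover have "tower (h + 7 + 7 * t) < m" using Suc.prems by (simp add: algebra_simps)
    ultimately show False using Suc.IH by blast
  qed
qed

end

lemma log_star_le_tower:
  assumes "x \<le> real (tower j)"
  shows "log_star x \<le> j"
proof -
  have "\<exists>k\<le>j. ((\<lambda>y. log 2 y) ^^ k) x \<le> 1"
    using assms
  proof (induction j arbitrary: x)
    case (Suc j)
    show ?case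
    \<comment> \<open>For \<open>x \<le> 1\<close> the iteration stops at once; this also keeps
      \<open>log 2\<close> away from nonpositive arguments.\<close>
    proof (cases "x \<le> 1")
      case True
      then show ?thesis by (intro exI[of _ 0]) simp
    next
      case False
      have "log 2 x \<le> log 2 (2 ^ tower j)" using False Suc.prems by (subst log_le_cancel_iff) auto
      then have "log 2 x \<le> real (tower j)" by simp
      then obtain k where "k \<le> j" "((\<lambda>y. log 2 y) ^^ k) (log 2 x) \<le> 1" using Suc.IH by blast
      then show ?thesis by (intro exI[of _ "Suc k"]) (simp add: funpow_swap1)
    qed
  qed simp
  then obtain k where "k \<le> j" "((\<lambda>y. log 2 y) ^^ k) x \<le> 1" by blast
  then show ?thesis unfolding log_star_def by (meson Least_le le_trans)
qed

declare sub_apply [simp del]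

context ported_trees
begin

subsection \<open>A linear order on the nodes of a tree\<close>

text \<open>Following Goos, Hirvonen and Suomela, a path has value the number of its forward edges minus its
  backward edges, plus a sign for every inner node telling whether the leaving port exceeds the entering
  one. This is a sum of an odd number of signs, hence nonzero, and it is negated by reversal; around a
  tripod all contributions cancel except those of its center, which gives transitivity.\<close>

definition edge_sign :: "nat \<Rightarrow> int" where "edge_sign p = (if p \<le> m then 1 else -1)"

definition turn_sign :: "nat \<Rightarrow> nat \<Rightarrow> int" where "turn_sign p q = sgn (int q - int p)"

fun descent :: "ptree \<Rightarrow> nat list \<Rightarrow> int" where
  "descent y [] = 0"
| "descent y (p # a) = edge_sign p + (if a = [] then 0 else turn_sign (y [p]) (hd a)) + descent (sub y p) a"

text \<open>The path to \<open>a\<close> that comes from outside the branch, without its entry edge: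
  the turn at the branch root is included.\<close>

definition entry_descent :: "ptree \<Rightarrow> nat list \<Rightarrow> int" where
  "entry_descent y a = (if a = [] then 0 else turn_sign (y []) (hd a) + descent y a)"

text \<open>Stripping the common prefix leads to the node where the ways to \<open>a\<close> and
  \<open>b\<close> part; the climb from \<open>a\<close> to it is a descent with opposite
  sign.\<close>

fun path_value :: "ptree \<Rightarrow> nat list \<Rightarrow> nat list \<Rightarrow> int" where
  "path_value y [] b = descent y b"
| "path_value y (p # a) [] = - descent y (p # a)"
| "path_value y (p # a) (q # b) = (if p =
    q then path_value (sub y p) a b else - descent y (p # a) + turn_sign p q + descent y (q # b))"

lemma turn_sign_swap: "turn_sign q p = - turn_sign p q"
  by (simp add: turn_sign_def sgn_if)

lemma turn_sign_odd: "p \<noteq> q \<Longrightarrow> odd (turn_sign p q)"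
  by (auto simp: turn_sign_def sgn_if)

lemma turn_sign_bounds: "- 1 \<le> turn_sign p q" "turn_sign p q \<le> 1"
  by (auto simp: turn_sign_def sgn_if)

text \<open>The three differences add up to zero, so their signs are never all positive or all
  negative, and if one is zero the other two cancel.\<close>

lemma turn_sign_cycle: "\<bar>turn_sign p q + turn_sign q r + turn_sign r p\<bar> \<le> 1"
  by (auto simp: turn_sign_def sgn_if)

lemma descent_Cons: "descent y (p # a) = edge_sign p + entry_descent (sub y p) a"
  by (simp add: entry_descent_def sub_apply)

lemma edge_sign_opposite: "opposite p q \<Longrightarrow> edge_sign q = - edge_sign p"
  by (auto simp: opposite_def edge_sign_def)

lemma path_value_Nil2 [simp]: "path_value y a [] = - descent y a"
  by (cases a) auto

lemma path_value_self [simp]: "path_value y a a = 0"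
  by (induction a arbitrary: y) auto

lemma path_value_anti: "path_value y b a = - path_value y a b"
proof (induction y a b rule: path_value.induct)
  case (3 y p a q b)
  then show ?case using turn_sign_swap[of p q] by (cases "p = q") (simp_all del: descent.simps)
qed (simp_all del: descent.simps)

lemma descent_odd: "reduced y a \<Longrightarrow> a \<noteq> [] \<Longrightarrow> odd (descent y a)"
proof (induction a arbitrary: y)
  case (Cons p a)
  have e: "odd (edge_sign p)" by (simp add: edge_sign_def)
  show ?case
  proof (cases "a = []")
    case False
    then have "y [p] \<noteq> hd a" "reduced (sub y p) a"
      using Cons.prems(1) by (cases a; simp add: sub_apply)+
    then show ?thesis using Cons.IH False e turn_sign_odd by simp
  qed (use e in simp)
qed simp

lemma path_value_odd: "reduced y a \<Longrightarrow> reduced y b \<Longrightarrow> a \<noteq> b \<Longrightarrow> odd (path_value y a b)"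
proof (induction y a b rule: path_value.induct)
  case (1 y b)
  then show ?case using descent_odd[of y b] by simp
next
  case (2 y p a)
  then show ?case using descent_odd[of y "p # a"] by (simp del: descent.simps)
next
  case (3 y p a q b)
  show ?case
  proof (cases "p = q")
    case True
    then show ?thesis using 3 by auto
  next
    case False
    have "odd (descent y (p # a))" "odd (descent y (q # b))" "odd (turn_sign p q)"
      using 3 False descent_odd turn_sign_odd by blast+
    then show ?thesis using False by (simp del: descent.simps)
  qed
qed

text \<open>The tripod of \<open>a\<close>, \<open>b\<close> and a third end outside the branch,
  reached through the entry port. It arises in \<open>path_value_tripod\<close> when two addresses
  share their first port and the third does not.\<close>

lemma path_value_via_entry: "\<bar>path_value y a b + entry_descent y a - entry_descent y b\<bar> \<le> 1"
proof (induction y a b rule: path_value.induct)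
  case (1 y b)
  show ?case using turn_sign_bounds[of "y []" "hd b"] by (cases "b = []") (auto simp: entry_descent_def)
next
  case (2 y p a)
  show ?case using turn_sign_bounds[of "y []" p] by (simp add: entry_descent_def del: descent.simps)
next
  case (3 y p a q b)
  show ?case
  proof (cases "p = q")
    case True
    then show ?thesis using 3 by (simp add: entry_descent_def[of y] descent_Cons del: descent.simps)
  next
    case False
    then show ?thesis
      using turn_sign_cycle[of "y []" p q] turn_sign_swap[of "y []" q]
          by (simp add: entry_descent_def del: descent.simps)
  qed
qed

lemma path_value_tripod: "\<bar>path_value y a b + path_value y b c + path_value y c a\<bar> \<le> 1"
proof (induction a arbitrary: y b c)
  case Nil
  show ?case
  proof (cases "b = [] \<or> c = []")
    case True
    then show ?thesis by auto
  next
    case False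
    then obtain q b' r c' where [simp]: "b = q # b'" "c = r # c'" by (meson neq_Nil_conv)
    show ?thesis
      using path_value_via_entry[of "sub y q" b' c'] turn_sign_bounds[of q r]
      by (cases "q = r") (simp_all add: descent_Cons del: descent.simps)
  qed
next
  case (Cons p a)
  show ?case
  proof (cases "b = [] \<or> c = []")
    case True
    then consider "b = []" "c = []" | r c' where "b = []" "c = r # c'" | q b' where "c = []" "b = q # b'"
      by (meson neq_Nil_conv)
    then show ?thesis
    proof cases
      case 1
      then show ?thesis by simp
    next
      case 2
      then show ?thesis
        using path_value_via_entry[of "sub y r" c' a] turn_sign_bounds[of r p]
        by (cases "r = p") (simp_all add: descent_Cons del: descent.simps)
    next
      case 3
      then show ?thesis
        using path_value_via_entry[of "sub y q" a b'] turn_sign_bounds[of p q]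
        by (cases "p = q") (simp_all add: descent_Cons del: descent.simps)
    qed
  next
    case False
    then obtain q b' r c' where [simp]: "b = q # b'" "c = r # c'" by (meson neq_Nil_conv)
    consider "p = q" "q = r" | "p = q" "q \<noteq> r" | "p \<noteq> q" "q = r" | "p \<noteq> q" "p = r"
        | "p \<noteq> q" "q \<noteq> r" "r \<noteq> p" by metis
    then show ?thesis
    proof cases
      case 1
      then show ?thesis using Cons[of "sub y p" b' c'] by simp
    next
      case 2
      then show ?thesis
        using path_value_via_entry[of "sub y p" a b'] turn_sign_swap[of p r]
            by (simp add: descent_Cons del: descent.simps)
    next
      case 3
      then show ?thesis
        using path_value_via_entry[of "sub y q" b' c'] turn_sign_swap[of p q]
            by (simp add: descent_Cons del: descent.simps)
    next
      case 4
      then show ?thesis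
        using path_value_via_entry[of "sub y p" c' a] turn_sign_swap[of p q]
            by (simp add: descent_Cons del: descent.simps)
    next
      case 5
      then show ?thesis using turn_sign_cycle[of p q r] by (simp del: descent.simps)
    qed
  qed
qed

text \<open>Both given values are at least 1 and the tripod sum is at most 1, so
  \<open>path_value y c a\<close> is at most -1.\<close>

lemma path_value_trans: "0 < path_value y a b \<Longrightarrow> 0 < path_value y b c \<Longrightarrow> 0 < path_value y a c"
  using path_value_tripod[of y a b c] path_value_anti[of y c a] by linarith

lemma path_value_total: "reduced y a \<Longrightarrow> reduced y b \<Longrightarrow> a \<noteq> b \<Longrightarrow> 0 < path_value y a b \<or> 0 < path_value y b a"
proof -
  assume "reduced y a" "reduced y b" "a \<noteq> b"
  then have "path_value y a b \<noteq> 0" using path_value_odd by force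
  then show ?thesis using path_value_anti[of y b a] by linarith
qed

lemma descent_cong: "agree (length a) x y \<Longrightarrow> descent x a = descent y a"
proof (induction a arbitrary: x y)
  case (Cons p a)
  have "x [p] = y [p]" using Cons.prems by (simp add: agree_def)
  moreover have "descent (sub x p) a = descent (sub y p) a"
    using Cons.prems by (intro Cons.IH) (simp add: agree_Suc)
  ultimately show ?case by simp
qed simp

lemma path_value_cong: "agree t x y \<Longrightarrow> length a \<le> t \<Longrightarrow> length b \<le> t \<Longrightarrow> path_value x a b = path_value y a b"
proof (induction a arbitrary: x y b t)
  case Nil
  then show ?case using descent_cong agree_mono by simp
next
  case (Cons p a)
  have d: "descent x c = descent y c" if "length c \<le> t" for c
      using descent_cong agree_mono that Cons.prems(1) by blast
  obtain s where t: "t = Suc s" using Cons.prems by (cases t) auto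
  show ?case
  proof (cases b)
    case Nil
    then show ?thesis using d[of "p # a"] Cons.prems by (simp del: descent.simps)
  next
    case (Cons q b')
    then show ?thesis
      using Cons.IH[of s "sub x p" "sub y p" b'] Cons.prems d[of "p # a"] d[of b] t
      by (auto simp: agree_Suc simp del: descent.simps)
  qed
qed

lemma reduced_cong: "agree t x y \<Longrightarrow> length a \<le> t \<Longrightarrow> reduced x a = reduced y a"
proof (induction a arbitrary: x y t)
  case (Cons p a)
  obtain s where "t = Suc s" using Cons.prems by (cases t) auto
  then show ?case using Cons.IH[of s "sub x p" "sub y p"] Cons.prems by (simp add: agree_Suc)
qed simp

lemma reduced_snoc: "reduced y (a @ [r]) \<longleftrightarrow> reduced y a \<and> r < port_count \<and> r \<noteq> y a"
  by (induction a arbitrary: y) (auto simp: sub_apply)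

section \<open>Addresses under a change of root\<close>

definition adj :: "ptree \<Rightarrow> nat list \<Rightarrow> nat list set" where
  "adj y a = (\<lambda>r. a @ [r]) ` ({..<port_count} - {y a}) \<union> (if a = [] then {} else {butlast a})"

text \<open>Translates addresses seen from the neighbor at port \<open>p\<close> into addresses seen
  from the root: a walk that starts back through \<open>x [p]\<close> loses this step, any other
  gains \<open>p\<close> in front.\<close>

definition reroot_address :: "ptree \<Rightarrow> nat \<Rightarrow> nat list \<Rightarrow> nat list" where
  "reroot_address x p a = (case a of [] \<Rightarrow> [p] | r # b \<Rightarrow> if r = x [p] then b else p # a)"

lemma reroot_address_Nil [simp]: "reroot_address x p [] = [p]"
  by (simp add: reroot_address_def)

lemma reroot_address_Cons [simp]: "reroot_address x p (r # b) = (if r = x [p] then b else p # r # b)"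
  by (simp add: reroot_address_def)

lemma length_reroot_address: "length (reroot_address x p a) \<le> Suc (length a)"
  by (cases a) auto

lemma reduced_cut: "valid_tree x \<Longrightarrow> reduced (cut x p) b \<longleftrightarrow> reduced x b \<and> (b = [] \<or> hd b \<noteq> p)"
  by (cases b) (auto simp: sub_cut valid_tree_Nil)

lemma reduced_rerootD:
  assumes "valid_tree x" "reduced (reroot x p) a"
  obtains "a = []" | b where "a = x [p] # b" "reduced x b" "b = [] \<or> hd b \<noteq> p"
    | r b where "a = r # b" "r \<noteq> x [p]" "reduced (sub x p) a"
proof (cases a)
  case (Cons r b)
  show ?thesis
  proof (cases "r = x [p]")
    case True
    then have "reduced (cut x p) b" using assms(2) Cons by (simp add: sub_reroot)
    then show ?thesis using that(2) True Cons reduced_cut[OF assms(1)] by blast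
  next
    case False
    then show ?thesis using that(3)[OF Cons] assms(2) Cons by (simp add: sub_reroot sub_apply)
  qed
qed (use that in blast)

lemma reduced_reroot_address:
  assumes "valid_tree x" "p < port_count" "reduced (reroot x p) a"
  shows "reduced x (reroot_address x p a)"
  using assms(1,3)
  by (rule reduced_rerootD) (use assms valid_tree_Nil[OF assms(1)] in auto)

lemma inj_reroot_address:
  assumes "valid_tree x" "reduced (reroot x p) a" "reduced (reroot x p) b" "reroot_address x p a =
      reroot_address x p b"
  shows "a = b"
  using assms(1,2)
proof (rule reduced_rerootD)
  assume a: "a = []"
  from assms(1,3) show ?thesis by (rule reduced_rerootD) (use a assms(4) in auto)
next
  fix a' assume a: "a = x [p] # a'" "a' = [] \<or> hd a' \<noteq> p"
  from assms(1,3) show ?thesis by (rule reduced_rerootD) (use a assms(4) in auto)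
next
  fix r a' assume a: "a = r # a'" "r \<noteq> x [p]"
  from assms(1,3) show ?thesis by (rule reduced_rerootD) (use a assms(4) in auto)
qed

lemma descent_cut: "b = [] \<or> hd b \<noteq> p \<Longrightarrow> descent (cut x p) b = descent x b"
  by (cases b) (auto simp: sub_cut)

lemma path_value_cut:
  assumes "a = [] \<or> hd a \<noteq> p" "b = [] \<or> hd b \<noteq> p"
  shows "path_value (cut x p) a b = path_value x a b"
proof (cases a)
  case Nil
  then show ?thesis using descent_cut[OF assms(2)] by simp
next
  case (Cons q a')
  then show ?thesis
    using descent_cut[OF assms(1), of x] descent_cut[OF assms(2), of x] assms
    by (cases b) (auto simp: sub_cut simp del: descent.simps)
qed

text \<open>The value belongs to the path and not to the root from which it is described, so
  neighboring nodes read off the same linear order. The cases are the sides of the edge on which the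
  two ends lie.\<close>

lemma path_value_reroot:
  assumes x: "valid_tree x" and p: "p < port_count" and a: "reduced (reroot x p) a" and b:
      "reduced (reroot x p) b"
  shows "path_value (reroot x p) a b = path_value x (reroot_address x p a) (reroot_address x p b)"
proof -
  let ?q = "x [p]"
  have e: "edge_sign ?q = - edge_sign p" using edge_sign_opposite valid_tree_opposite[OF x p] by blast
  have down: "descent (reroot x p) c = descent (sub x p) c" if "c = [] \<or> hd c \<noteq> ?q" for c
    using that by (cases c) (auto simp: sub_reroot reroot_Cons sub_apply)
  \<comment> \<open>Seen from the neighbor, the walk back over the edge to \<open>c\<close> is the
    reversal of the path from \<open>c\<close> to \<open>[p]\<close>.\<close>
  have up: "descent (reroot x p) (?q # c) = - path_value x c [p]" if "c = [] \<or> hd c \<noteq> p" for c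
    using that descent_cut[OF that, of x] turn_sign_swap[of p "hd c"] e
    by (cases c) (auto simp: descent_Cons[of
        "reroot x p"] sub_reroot entry_descent_def descent_Cons[of x] simp del: descent.simps)
  \<comment> \<open>A path across the edge splits at the node \<open>[p]\<close>; the turn at that
    node is part of \<open>entry_descent\<close>.\<close>
  have up2: "path_value x c (p # d) = path_value x c [p] + entry_descent (sub x p) d" if "c = [] \<or>
      hd c \<noteq> p" for c d
    using that by (cases c) (auto simp: descent_Cons entry_descent_def[of _ "[]"] simp del: descent.simps)
  from x a show ?thesis
  proof (rule reduced_rerootD)
    assume a0: "a = []"
    from x b show ?thesis
    proof (rule reduced_rerootD)
      assume "b = []" then show ?thesis using a0 by simp
    next
      fix b' assume b': "b = ?q # b'" "b' = [] \<or> hd b' \<noteq> p"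
      then show ?thesis using a0 up path_value_anti[of x "[p]" b'] by (simp del: descent.simps)
    next
      fix r b' assume b': "b = r # b'" "r \<noteq> ?q"
      then show ?thesis using a0 down[of b] by (simp del: descent.simps)
    qed
  next
    fix a' assume a': "a = ?q # a'" "a' = [] \<or> hd a' \<noteq> p"
    from x b show ?thesis
    proof (rule reduced_rerootD)
      assume "b = []"
      then show ?thesis using a' up[of a'] by (simp del: descent.simps)
    next
      fix b' assume b': "b = ?q # b'" "b' = [] \<or> hd b' \<noteq> p"
      then show ?thesis using a' path_value_cut by (simp add: sub_reroot del: descent.simps)
    next
      fix r b' assume b': "b = r # b'" "r \<noteq> ?q"
      then show ?thesis
        using a' up[of a'] up2[of a' b] down[of b] by (simp add: entry_descent_def sub_apply del: descent.simps)
    qed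
  next
    fix r a' assume a': "a = r # a'" "r \<noteq> ?q"
    from x b show ?thesis
    proof (rule reduced_rerootD)
      assume "b = []"
      then show ?thesis using a' down[of a] by (simp del: descent.simps)
    next
      fix b' assume b': "b = ?q # b'" "b' = [] \<or> hd b' \<noteq> p"
      then show ?thesis
        using a' up[of b'] up2[of b' a] down[of a] turn_sign_swap[of r ?q] path_value_anti[of x b' "p # a"]
        by (simp add: entry_descent_def sub_apply del: descent.simps)
    next
      fix s b' assume b': "b = s # b'" "s \<noteq> ?q"
      then show ?thesis
        using a' down[of a] down[of b] by (simp add: sub_reroot del: descent.simps)
    qed
  qed
qed

lemma reroot_address_adj:
  assumes x: "valid_tree x" and p: "p < port_count" and a: "reduced (reroot x p) a"
  shows "reroot_address x p ` adj (reroot x p) a = adj x (reroot_address x p a)"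
proof -
  let ?q = "x [p]"
  have q: "?q < port_count" using valid_tree_opposite[OF x p] opposite_less by blast
  from x a show ?thesis
  proof (rule reduced_rerootD)
    assume a0: "a = []"
    have "reroot_address x p ` adj (reroot x p) [] = (\<lambda>r. reroot_address x p [r]) ` {..<port_count}"
      by (simp add: adj_def image_image)
    also have "{..<port_count} = insert ?q ({..<port_count} - {?q})" using q by auto
    also have "(\<lambda>r. reroot_address x p [r]) ` \<dots> = insert [] ((\<lambda>r. [p, r]) ` ({..<port_count} - {?q}))"
      by (auto simp: image_iff)
    finally show ?thesis using a0 by (simp add: adj_def)
  next
    fix b assume b: "a = ?q # b" "b = [] \<or> hd b \<noteq> p"
    show ?thesis
    proof (cases "b = []")
      case True
      have "reroot_address x p ` adj (reroot x p) a = insert [p] ((\<lambda>r. [r]) ` ({..<port_count} - {p}))"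
        using True b by (simp add: adj_def image_image)
      also have "\<dots> = (\<lambda>r. [r]) ` (insert p ({..<port_count} - {p}))" by auto
      also have "insert p ({..<port_count} - {p}) = {..<port_count}" using p by auto
      finally show ?thesis using True b valid_tree_Nil[OF x] by (simp add: adj_def)
    next
      case False
      then have "reroot x p a = x b" using b by (cases b) (auto simp: reroot_Cons)
      then show ?thesis using False b by (simp add: adj_def image_image)
    qed
  next
    fix r b assume b: "a = r # b" "r \<noteq> ?q"
    then have "reroot x p a = x (p # a)" by (simp add: reroot_Cons)
    then show ?thesis using b by (auto simp: adj_def image_image)
  qed
qed

lemma entry_less:
  assumes "valid_tree x" "reduced x a" "a \<noteq> []"
  shows "x a < port_count"
proof -
  have "opposite (last a) (x a)" using assms unfolding valid_tree_def valid_branch_def by simp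
  then show ?thesis by (rule opposite_less(2))
qed

lemma card_adj:
  assumes x: "valid_tree x" and a: "reduced x a"
  shows "card (adj x a) = port_count"
proof (cases "a = []")
  case True
  then show ?thesis using valid_tree_Nil[OF x] by (simp add: adj_def card_image inj_on_def)
next
  case False
  have "card ((\<lambda>r. a @ [r]) ` ({..<port_count} - {x a})) = port_count - 1"
    using entry_less[OF x a False] by (simp add: card_image inj_on_def)
  moreover have "butlast a \<notin> (\<lambda>r. a @ [r]) ` ({..<port_count} - {x a})"
  proof
    assume "butlast a \<in> (\<lambda>r. a @ [r]) ` ({..<port_count} - {x a})"
    then obtain r where "butlast a = a @ [r]" by blast
    then have "length (butlast a) = Suc (length a)" by (metis length_append_singleton)
    then show False by simp
  qed
  ultimately show ?thesis using False by (simp add: adj_def) (simp add: port_count_def)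
qed

section \<open>Sizes of balls\<close>

definition ball :: "ptree \<Rightarrow> nat \<Rightarrow> nat list set" where
  "ball y t = {a. reduced y a \<and> length a \<le> t}"

primrec branch_size :: "nat \<Rightarrow> nat" where
  "branch_size 0 = 1"
| "branch_size (Suc t) = Suc ((port_count - 1) * branch_size t)"

definition ball_size :: "nat \<Rightarrow> nat" where
  "ball_size t = (case t of 0 \<Rightarrow> 1 | Suc s \<Rightarrow> Suc (port_count * branch_size s))"

lemma ball_0: "ball y 0 = {[]}"
  by (auto simp: ball_def)

lemma ball_Suc: "ball y (Suc t) = insert [] (\<Union>p\<in>{..<port_count} - {y []}. (#) p ` ball (sub y p) t)"
proof (intro set_eqI)
  fix a
  show "a \<in> ball y (Suc t) \<longleftrightarrow> a \<in> insert [] (\<Union>p\<in>{..<port_count} - {y []}. (#) p ` ball (sub y p) t)"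
    by (cases a) (auto simp: ball_def)
qed

lemma finite_ball: "finite (ball y t)"
  by (induction t arbitrary: y) (simp_all add: ball_0 ball_Suc)

lemma card_ball_Suc:
  assumes "\<And>p. p \<in> {..<port_count} - {y []} \<Longrightarrow> card (ball (sub y p) t) = n"
  shows "card (ball y (Suc t)) = Suc (card ({..<port_count} - {y []}) * n)"
proof -
  have "card (\<Union>p\<in>{..<port_count} - {y []}. (#) p ` ball (sub y p) t) =
      (\<Sum>p\<in>{..<port_count} - {y []}. card ((#) p ` ball (sub y p) t))"
    by (rule card_UN_disjoint) (auto simp: finite_ball)
  also have "\<dots> = (\<Sum>p\<in>{..<port_count} - {y []}. n)"
    using assms by (intro sum.cong) (auto simp: card_image)
  also have "\<dots> = card ({..<port_count} - {y []}) * n" by simp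
  finally show ?thesis unfolding ball_Suc by (subst card_insert_disjoint) (auto simp: finite_ball)
qed

lemma card_branch: "valid_branch y \<Longrightarrow> y [] < port_count \<Longrightarrow> card (ball y t) = branch_size t"
proof (induction t arbitrary: y)
  case (Suc t)
  have "card (ball (sub y p) t) = branch_size t" if "p \<in> {..<port_count} - {y []}" for p
  proof (rule Suc.IH)
    have "opposite p (y [p]) \<and> valid_branch (sub y p)"
      using Suc.prems(1)[unfolded valid_branch_iff[of y], rule_format, of p] that by simp
    then show "valid_branch (sub y p)" "sub y p [] < port_count" using opposite_less(2)
        by (auto simp: sub_apply)
  qed
  then show ?case using card_ball_Suc[of y t] Suc.prems(2) by simp
qed (simp add: ball_0)

text \<open>Because the size is independent of the tree, Ramsey's theorem for subsets of one fixed
  size can treat all trees together.\<close>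

lemma card_ball:
  assumes x: "valid_tree x"
  shows "card (ball x t) = ball_size t"
proof (cases t)
  case (Suc s)
  have "card (ball (sub x p) s) = branch_size s" if "p \<in> {..<port_count} - {x []}" for p
  proof (rule card_branch)
    have "opposite p (x [p]) \<and> valid_branch (sub x p)" using x that unfolding valid_tree_iff by simp
    then show "valid_branch (sub x p)" "sub x p [] < port_count" using opposite_less(2)
        by (auto simp: sub_apply)
  qed
  then show ?thesis using card_ball_Suc[of x s] valid_tree_Nil[OF x] Suc by (simp add: ball_size_def)
qed (simp add: ball_0 ball_size_def)

lemma ball_cong: "agree t x y \<Longrightarrow> ball x t = ball y t"
  unfolding ball_def using reduced_cong[of t x y] by (intro Collect_cong) blast

end

subsection \<open>Graphs with odd degrees\<close>

definition edge_rel :: "graph \<Rightarrow> (nat \<times> nat) set" where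
  "edge_rel G = {(a, b). {a, b} \<in> snd G}"

lemma sym_edge_rel: "sym (edge_rel G)"
  by (auto simp: sym_def edge_rel_def insert_commute)

lemma reach_of_rtrancl: "(v, u) \<in> (edge_rel G)\<^sup>* \<Longrightarrow> v \<in> fst G \<Longrightarrow> \<exists>k. reach_le G v u k"
proof (induction rule: rtrancl_induct)
  case base
  then show ?case by (intro exI[of _ 0]) simp
next
  case (step w u)
  then obtain k where "reach_le G v w k" by blast
  moreover have "{w, u} \<in> snd G" using step.hyps(2) by (simp add: edge_rel_def)
  ultimately have "reach_le G v u (Suc k)" by auto
  then show ?case by blast
qed

lemma rtrancl_of_reach: "reach_le G v u k \<Longrightarrow> (v, u) \<in> (edge_rel G)\<^sup>*"
proof (induction k arbitrary: u)
  case (Suc k)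
  then show ?case
    by (auto simp: edge_rel_def intro: rtrancl_into_rtrancl)
qed simp

lemma connected_graphI:
  assumes "r \<in> fst G" "\<And>u. u \<in> fst G \<Longrightarrow> (r, u) \<in> (edge_rel G)\<^sup>*"
  shows "connected_graph G"
  unfolding connected_graph_def
proof (intro ballI)
  fix u w assume "u \<in> fst G" "w \<in> fst G"
  then have "(u, w) \<in> (edge_rel G)\<^sup>*"
    using assms sym_rtrancl[OF sym_edge_rel] by (meson rtrancl_trans symD)
  then show "\<exists>k. reach_le G u w k" using reach_of_rtrancl \<open>u \<in> fst G\<close> by blast
qed

definition odd_graph :: "nat \<Rightarrow> graph \<Rightarrow> bool" where
  "odd_graph d G \<longleftrightarrow> simple_graph G \<and> connected_graph G \<and> (\<forall>v\<in>fst G. odd (deg G v) \<and> deg G v \<le> d)"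

lemma nbrs_in: "simple_graph G \<Longrightarrow> u \<in> nbrs G v \<Longrightarrow> u \<in> fst G \<and> v \<in> fst G"
  by (auto simp: simple_graph_def nbrs_def)

text \<open>Two new leaves raise the degree of the old leaf \<open>l\<close> from 1 to 3, so all
  degrees stay odd and at most \<open>d\<close>; \<open>x\<close> is a leaf for the next
  step.\<close>

lemma add_two_leaves:
  assumes G: "odd_graph d (V, E)" and l: "l \<in> V" "deg (V, E) l = 1" and d: "3 \<le> d"
    and xy: "x \<notin> V" "y \<notin> V" "x \<noteq> y"
  defines "G' \<equiv> (V \<union> {x, y}, E \<union> {{l, x}, {l, y}})"
  shows "odd_graph d G'" "deg G' x = 1" "\<And>v. v \<in> V - {l} \<Longrightarrow> nbrs G' v = nbrs (V, E) v"
proof -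
  have sg: "simple_graph (V, E)" and con: "connected_graph (V, E)" using G by (auto simp: odd_graph_def)
  have EV: "\<And>e. e \<in> E \<Longrightarrow> e \<subseteq> V \<and> card e = 2" and fin: "finite V"
      using sg by (auto simp: simple_graph_def)
  have no: "{u, x} \<notin> E" "{u, y} \<notin> E" for u using EV xy by blast+
  have lx: "l \<noteq> x" "l \<noteq> y" using l xy by auto
  show nb: "nbrs G' v = nbrs (V, E) v" if "v \<in> V - {l}" for v
    using that xy by (auto simp: nbrs_def G'_def doubleton_eq_iff)
  have nx: "nbrs G' x = {l}" "nbrs G' y = {l}"
    using no xy lx by (auto simp: nbrs_def G'_def doubleton_eq_iff)
  have nl: "nbrs G' l = nbrs (V, E) l \<union> {x, y}"
    by (auto simp: nbrs_def G'_def doubleton_eq_iff)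
  show dx: "deg G' x = 1" using nx by (simp add: deg_def)
  have dy: "deg G' y = 1" using nx by (simp add: deg_def)
  have "nbrs (V, E) l \<inter> {x, y} = {}" using nbrs_in[OF sg] xy by auto
  moreover have "finite (nbrs (V, E) l)" using nbrs_in[OF sg] fin by (auto intro: finite_subset[of _ V])
  ultimately have dl: "deg G' l = 3"
    using l(2) xy(3) unfolding deg_def nl by (subst card_Un_disjoint) auto
  have "odd (deg G' v) \<and> deg G' v \<le> d" if v: "v \<in> fst G'" for v
  proof -
    consider "v = x" | "v = y" | "v = l" | "v \<in> V - {l}" using v by (auto simp: G'_def)
    then show ?thesis
    proof cases
      case 4
      then have "deg G' v = deg (V, E) v" using nb by (simp add: deg_def)
      then show ?thesis using G 4 by (simp add: odd_graph_def)
    qed (use dx dy dl d in auto)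
  qed
  moreover have "simple_graph G'"
    unfolding simple_graph_def using fin EV l(1) lx by (auto simp: G'_def)
  moreover have "connected_graph G'"
  proof (rule connected_graphI[of l])
    show "l \<in> fst G'" using l by (simp add: G'_def)
    fix u assume "u \<in> fst G'"
    then consider "u = x" | "u = y" | "u \<in> V" by (auto simp: G'_def)
    then show "(l, u) \<in> (edge_rel G')\<^sup>*"
    proof cases
      case 3
      then obtain k where "reach_le (V, E) l u k" using con l(1) unfolding connected_graph_def by auto
      then have "(l, u) \<in> (edge_rel (V, E))\<^sup>*" by (rule rtrancl_of_reach)
      moreover have "edge_rel (V, E) \<subseteq> edge_rel G'" by (auto simp: edge_rel_def G'_def)
      ultimately show ?thesis using rtrancl_mono by blast
    qed (auto simp: edge_rel_def G'_def)
  qed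
  ultimately show "odd_graph d G'" by (auto simp: odd_graph_def)
qed

text \<open>Brings the number of nodes up to the \<open>n\<close> that the algorithm is told. Nodes
  are added in pairs, hence the even \<open>card X\<close>, and among the old nodes only the leaf
  \<open>l\<close> gets a new neighborhood.\<close>

lemma pad_odd_graph:
  assumes "odd_graph d (V, E)" "l \<in> V" "deg (V, E) l = 1" "3 \<le> d"
    and "card X = 2 * j" "finite X" "X \<inter> V = {}"
  shows "\<exists>E'. odd_graph d (V \<union> X, E') \<and> (\<forall>v\<in>V - {l}. nbrs (V \<union> X, E') v = nbrs (V, E) v)"
  using assms
proof (induction j arbitrary: V E l X)
  case 0
  then show ?case by auto
next
  case (Suc j)
  have "2 \<le> card X" using Suc.prems by simp
  then obtain Y where Y: "Y \<subseteq> X" "card Y = 2" by (meson obtain_subset_with_card_n)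
  then obtain x y where xy: "Y = {x, y}" "x \<noteq> y" by (meson card_2_iff)
  let ?V = "V \<union> {x, y}" and ?E = "E \<union> {{l, x}, {l, y}}"
  have xyV: "x \<notin> V" "y \<notin> V" using Suc.prems(7) Y xy by auto
  note two = add_two_leaves[OF Suc.prems(1-4) xyV xy(2)]
  have "card (X - Y) = 2 * j"
    using Suc.prems(5,6) Y by (simp add: card_Diff_subset finite_subset)
  then have "\<exists>E'. odd_graph d (?V \<union> (X - Y), E') \<and> (\<forall>v\<in>?V - {x}. nbrs (?V \<union> (X - Y), E') v = nbrs (?V, ?E) v)"
    using two(1,2) Suc.prems xy by (intro Suc.IH) auto
  moreover have "?V \<union> (X - Y) = V \<union> X" using Y xy by auto
  ultimately obtain E' where E': "odd_graph d (V \<union> X, E')" "\<forall>v\<in>?V - {x}. nbrs (V \<union> X, E') v = nbrs (?V, ?E) v"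
    by auto
  have "nbrs (V \<union> X, E') v = nbrs (V, E) v" if "v \<in> V - {l}" for v
    using E'(2) two(3)[OF that] that xyV by auto
  then show ?case using E'(1) by blast
qed

section \<open>Order-preserving placement of identifiers\<close>

definition order_iso :: "'a set \<Rightarrow> ('a \<Rightarrow> 'a \<Rightarrow> bool) \<Rightarrow> nat set \<Rightarrow> ('a \<Rightarrow> nat) \<Rightarrow> bool" where
  "order_iso B r S f \<longleftrightarrow> bij_betw f B S \<and> (\<forall>a\<in>B. \<forall>b\<in>B. r a b \<longleftrightarrow> f a < f b)"

lemma ex_order_iso:
  assumes B: "finite B" and S: "finite S" "card S = card B"
    and tr: "\<And>a b c. r a b \<Longrightarrow> r b c \<Longrightarrow> r a c" and ir: "\<And>a. \<not> r a a"
    and tot: "\<And>a b. a \<in> B \<Longrightarrow> b \<in> B \<Longrightarrow> a \<noteq> b \<Longrightarrow> r a b \<or> r b a"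
  shows "\<exists>f. order_iso B r S f"
proof -
  define rk where "rk a = card {b\<in>B. r b a}" for a
  have less: "rk a < rk b" if "a \<in> B" "r a b" for a b
    unfolding rk_def
  proof (rule psubset_card_mono)
    show "finite {c\<in>B. r c b}" using B by simp
    show "{c\<in>B. r c a} \<subset> {c\<in>B. r c b}" using tr ir that by blast
  qed
  have iff: "r a b \<longleftrightarrow> rk a < rk b" if "a \<in> B" "b \<in> B" for a b
    using less[of a b] less[of b a] tot[of a b] that by force
  have inj: "inj_on rk B"
    using tot less by (auto intro!: inj_onI) (metis less_irrefl)
  have lt: "rk a < card B" if "a \<in> B" for a
    unfolding rk_def using that B ir by (intro psubset_card_mono) auto
  have bij: "bij_betw rk B {..<card B}"
    unfolding bij_betw_def
  proof
    show "rk ` B = {..<card B}"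
      using lt card_image[OF inj] by (intro card_subset_eq) auto
  qed (rule inj)
  define xs where "xs = sorted_list_of_set S"
  have len: "length xs = card B" using S by (simp add: xs_def)
  have "bij_betw ((!) xs) {..<card B} S"
    by (rule bij_betw_nth) (use len S(1) in \<open>simp_all add: xs_def\<close>)
  then have "bij_betw ((!) xs \<circ> rk) B S" by (rule bij_betw_trans[OF bij])
  moreover have "r a b \<longleftrightarrow> ((!) xs \<circ> rk) a < ((!) xs \<circ> rk) b" if
      "a \<in> B" "b \<in> B" for a b
  proof -
    have sorted: "xs ! i < xs ! j" if "i < j" "j < card B" for i j
      using that len unfolding xs_def by (simp add: sorted_wrt_nth_less)
    show ?thesis
      using sorted[of "rk a" "rk b"] sorted[of "rk b" "rk a"] lt[OF that(1)] lt[OF that(2)] iff[OF that]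
      by (cases "rk a" "rk b" rule: linorder_cases) auto
  qed
  ultimately show ?thesis unfolding order_iso_def by blast
qed

lemma order_iso_rank:
  assumes "order_iso B r S f" "a \<in> B"
  shows "card {x\<in>S. x < f a} = card {b\<in>B. r b a}"
proof -
  have S: "S = f ` B" and inj: "inj_on f B"
    using assms(1) by (auto simp: order_iso_def bij_betw_def)
  have "{x\<in>S. x < f a} = f ` {b\<in>B. r b a}"
    using assms unfolding S order_iso_def by auto
  then show ?thesis using inj by (simp add: card_image inj_on_subset)
qed

text \<open>An element of the finite set \<open>S\<close> is determined by the number of smaller
  ones, and this number is the rank of \<open>a\<close> in \<open>B\<close>.\<close>

lemma order_iso_unique:
  assumes "order_iso B r S f" "order_iso B r S g" "finite S" "a \<in> B"
  shows "f a = g a"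
proof -
  have eq: "card {x\<in>S. x < f a} = card {x\<in>S. x < g a}"
    using order_iso_rank[OF assms(1,4)] order_iso_rank[OF assms(2,4)] by simp
  have mono: "card {x\<in>S. x < y} < card {x\<in>S. x < z}" if "y \<in> S" "y < z" for y z
    using that assms(3) by (intro psubset_card_mono) auto
  have "f a \<in> S" "g a \<in> S" using assms by (auto simp: order_iso_def bij_betw_def)
  then show ?thesis
    using mono[of "f a" "g a"] mono[of "g a" "f a"] eq by (cases "f a" "g a" rule: linorder_cases) auto
qed

context ported_trees
begin

subsection \<open>Simulation of LOCAL algorithms\<close>

lemma reduced_butlast: "reduced x a \<Longrightarrow> reduced x (butlast a)"
  by (cases a rule: rev_cases) (auto simp: reduced_snoc)

lemma ball_butlast: "a \<in> ball x t \<Longrightarrow> butlast a \<in> ball x (t - 1)"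
  using reduced_butlast by (auto simp: ball_def)

lemma adj_ball: "a \<in> ball x t \<Longrightarrow> adj x a \<subseteq> ball x (Suc t)"
  using reduced_butlast by (auto simp: ball_def adj_def reduced_snoc)

lemma child_adj:
  assumes "reduced x a" "a \<noteq> []"
  shows "a \<in> adj x (butlast a)"
proof -
  obtain b r where a: "a = b @ [r]" using assms(2) by (metis rev_exhaust)
  then show ?thesis using assms(1) by (simp add: adj_def reduced_snoc)
qed

lemma ball_step: "ball x t \<union> (\<Union>a\<in>ball x t. adj x a) = ball x (Suc t)"
proof
  show "ball x t \<union> (\<Union>a\<in>ball x t. adj x a) \<subseteq> ball x (Suc t)"
    using adj_ball by (auto simp: ball_def)
  show "ball x (Suc t) \<subseteq> ball x t \<union> (\<Union>a\<in>ball x t. adj x a)"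
  proof
    fix a assume a: "a \<in> ball x (Suc t)"
    show "a \<in> ball x t \<union> (\<Union>a\<in>ball x t. adj x a)"
    proof (cases "a = []")
      case True
      then show ?thesis by (simp add: ball_def)
    next
      case False
      then have "a \<in> adj x (butlast a)" using child_adj a by (simp add: ball_def)
      moreover have "butlast a \<in> ball x t" using ball_butlast[OF a] by simp
      ultimately show ?thesis by blast
    qed
  qed
qed

text \<open>The view of the root of \<open>x\<close> when the node with address \<open>a\<close> has identifier \<open>e a\<close>.\<close>

definition canonical_view :: "ptree \<Rightarrow> nat \<Rightarrow> (nat list \<Rightarrow> nat) \<Rightarrow> view" where
  "canonical_view x t e = (e ` ball x t, (\<lambda>a. {e a, e (butlast a)}) ` (ball x t - {[]}),
     (\<lambda>u. if u \<in> e ` ball x t then port_count else 0))"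

lemma canonical_view_cong:
  assumes "\<And>a. a \<in> ball x t \<Longrightarrow> e a = e' a"
  shows "canonical_view x t e = canonical_view x t e'"
proof -
  have i: "e ` ball x t = e' ` ball x t" using assms by (intro image_cong) auto
  have "(\<lambda>a. {e a, e (butlast a)}) ` (ball x t - {[]}) = (\<lambda>a. {e' a, e' (butlast a)}) ` (ball x t - {[]})"
  proof (rule image_cong)
    fix a assume a: "a \<in> ball x t - {[]}"
    then have "butlast a \<in> ball x t" using ball_butlast[of a x t] by (auto simp: ball_def)
    then show "{e a, e (butlast a)} = {e' a, e' (butlast a)}" using assms a by auto
  qed simp
  with i show ?thesis by (simp add: canonical_view_def)
qed

text \<open>By induction on the radius, the reached nodes are the images of the balls. Injectivity
  reaches one step beyond \<open>t\<close>, because the view contains the degrees of the nodes at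
  distance \<open>t\<close>.\<close>

lemma local_view_eq_canonical_view:
  assumes x: "valid_tree x" and G: "simple_graph G" and r: "e [] \<in> fst G"
    and inj: "inj_on e (ball x (Suc t))"
    and nb: "\<And>a. a \<in> ball x t \<Longrightarrow> nbrs G (e a) = e ` adj x a"
  shows "local_view G t (e []) = canonical_view x t e"
proof -
  have mono: "ball x k \<subseteq> ball x t" if "k \<le> t" for k using that by (auto simp: ball_def)
  have edge: "{w, u} \<in> snd G \<longleftrightarrow> u \<in> nbrs G w" for w u
      by (simp add: nbrs_def insert_commute)
  have reach: "reach_le G (e []) u k \<longleftrightarrow> u \<in> e ` ball x k" if "k \<le> t" for u k
    using that
  proof (induction k arbitrary: u)
    case 0
    then show ?case using r by (auto simp: ball_0)
  next
    case (Suc k)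
    have nb': "nbrs G (e a) = e ` adj x a" if "a \<in> ball x k" for a
      using that nb mono[of k] Suc.prems by auto
    have "reach_le G (e []) u (Suc k) \<longleftrightarrow> u \<in> e ` ball x k \<or> (\<exists>w\<in>e ` ball x k. u \<in> nbrs G w)"
      using Suc by (auto simp: edge)
    also have "\<dots> \<longleftrightarrow> u \<in> e ` ball x k \<or> (\<exists>a\<in>ball x k. u \<in> e ` adj x a)"
      using nb' by simp
    also have "\<dots> \<longleftrightarrow> u \<in> e ` (ball x k \<union> (\<Union>a\<in>ball x k. adj x a))" by blast
    finally show ?case unfolding ball_step .
  qed
  have "{f \<in> snd G. \<exists>u\<in>f. t > 0 \<and> reach_le G (e []) u (t - 1)} =
      (\<lambda>a. {e a, e (butlast a)}) ` (ball x t - {[]})"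
    (is "?L = ?R")
  proof (intro subset_antisym subsetI)
    fix f assume f: "f \<in> ?L"
    then obtain u where u: "u \<in> f" "t > 0" "reach_le G (e []) u (t - 1)" and fG: "f \<in> snd G" by blast
    then obtain a where a: "a \<in> ball x (t - 1)" "u = e a" using reach[of "t - 1"] by auto
    have "card f = 2" using G fG by (auto simp: simple_graph_def)
    then obtain w where w: "f = {u, w}" using u(1) by (auto simp: card_2_iff)
    then have "w \<in> nbrs G (e a)" using fG a edge by simp
    then obtain b where b: "b \<in> adj x a" "w = e b" using nb[of a] mono[of "t - 1"] a by auto
    have bt: "b \<in> ball x t" using adj_ball[OF a(1)] b(1) u(2) by auto
    consider s where "b = a @ [s]" | "a \<noteq> []" "b = butlast a" using b(1)
        by (auto simp: adj_def split: if_splits)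
    then show "f \<in> ?R"
    proof cases
      case 1
      then have "f = {e b, e (butlast b)}" using w a b by auto
      then show ?thesis using bt 1 by blast
    next
      case 2
      then have "f = {e a, e (butlast a)}" using w a b by auto
      moreover have "a \<in> ball x t" using a(1) mono[of "t - 1"] by auto
      ultimately show ?thesis using 2 by blast
    qed
  next
    fix f assume "f \<in> ?R"
    then obtain a where a: "a \<in> ball x t" "a \<noteq> []" "f = {e a, e (butlast a)}" by blast
    have t: "t > 0" using a(1,2) by (cases t) (auto simp: ball_0)
    have b: "butlast a \<in> ball x (t - 1)" using ball_butlast[OF a(1)] .
    have "a \<in> adj x (butlast a)" using child_adj a by (simp add: ball_def)
    then have "e a \<in> nbrs G (e (butlast a))" using nb[of "butlast a"] b mono[of "t - 1"] by auto
    then have "f \<in> snd G" using a(3) by (simp add: nbrs_def)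
    moreover have "reach_le G (e []) (e (butlast a)) (t - 1)" using reach[of "t - 1"] b by auto
    ultimately show "f \<in> ?L" using a(3) t by blast
  qed
  moreover have "{u. reach_le G (e []) u t} = e ` ball x t" using reach[of t] by auto
  moreover have "(\<lambda>u. if reach_le G (e []) u t then deg G u else 0) =
      (\<lambda>u. if u \<in> e ` ball x t then port_count else 0)"
  proof
    fix u
    have "deg G (e a) = port_count" if a: "a \<in> ball x t" for a
    proof -
      have "inj_on e (adj x a)" using inj adj_ball[OF a] by (rule inj_on_subset)
      then have "card (e ` adj x a) = card (adj x a)" by (rule card_image)
      then show ?thesis using card_adj[OF x, of a] a nb[OF a] by (simp add: deg_def ball_def)
    qed
    then show "(if reach_le G (e []) u t then deg G u else 0) = (if u \<in> e ` ball x t then port_count else 0)"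
      using reach[of t u] by auto
  qed
  ultimately show ?thesis unfolding local_view_def canonical_view_def by simp
qed

section \<open>Finite odd-degree graphs containing a ball of the tree\<close>

definition tree_graph :: "ptree \<Rightarrow> nat \<Rightarrow> (nat list \<Rightarrow> nat) \<Rightarrow> graph" where
  "tree_graph x L i = (i ` ball x L, (\<lambda>a. {i a, i (butlast a)}) ` (ball x L - {[]}))"

lemma nbrs_tree_graph:
  assumes inj: "inj_on i (ball x L)" and a: "a \<in> ball x L"
  shows "nbrs (tree_graph x L i) (i a) =
    (if length a < L then i ` adj x a else if a = [] then {} else {i (butlast a)})"
proof -
  have bl: "butlast b \<in> ball x L" if "b \<in> ball x L" for b
    using ball_butlast[OF that] by (auto simp: ball_def)
  have eq: "i b = i c \<longleftrightarrow> b = c" if "b \<in> ball x L" "c \<in> ball x L" for b c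
    using inj_on_eq_iff[OF inj that] .
  have "u \<in> nbrs (tree_graph x L i) (i a) \<longleftrightarrow>
      u \<in> i ` {b \<in> ball x L. b \<noteq> [] \<and> butlast b = a} \<union> (if a = [] then {} else {i (butlast a)})" for u
  proof -
    have "u \<in> nbrs (tree_graph x L i) (i a) \<longleftrightarrow> (\<exists>b\<in>ball x L. b \<noteq> [] \<and> {u, i a} = {i b, i (butlast b)})"
      by (auto simp: nbrs_def tree_graph_def)
    also have "\<dots> \<longleftrightarrow> (\<exists>b\<in>ball x L. b \<noteq> [] \<and> (u = i b \<and> a = butlast b \<or> u = i (butlast b) \<and> a = b))"
      using eq a bl by (auto simp: doubleton_eq_iff)
    also have "\<dots> \<longleftrightarrow> u \<in> i ` {b \<in> ball x L. b \<noteq> [] \<and> butlast b = a} \<union> (if a = [] then {} else {i (butlast a)})"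
      using a by auto
    finally show ?thesis .
  qed
  then have nb: "nbrs (tree_graph x L i) (i a) =
      i ` {b \<in> ball x L. b \<noteq> [] \<and> butlast b = a} \<union> (if a = [] then {} else {i (butlast a)})" by blast
  have "{b \<in> ball x L. b \<noteq> [] \<and> butlast b = a} =
      (if length a < L then (\<lambda>r. a @ [r]) ` ({..<port_count} - {x a}) else {})" (is "?S = ?T")
  proof (intro subset_antisym subsetI)
    fix b assume b: "b \<in> ?S"
    then obtain s where "b = a @ [s]" by (metis (mono_tags, lifting) append_butlast_last_id mem_Collect_eq)
    then show "b \<in> ?T" using b by (auto simp: ball_def reduced_snoc)
  next
    fix b assume "b \<in> ?T"
    then show "b \<in> ?S" using a by (auto simp: ball_def reduced_snoc split: if_splits)
  qed
  then show ?thesis unfolding nb adj_def by (simp add: image_Un)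
qed

text \<open>Inner nodes have the odd degree \<open>2 * m + 1\<close>, and truncation leaves degree 1
  at depth \<open>L\<close>.\<close>

lemma odd_tree_graph:
  assumes x: "valid_tree x" and L: "0 < L" and inj: "inj_on i (ball x L)"
  shows "odd_graph port_count (tree_graph x L i)"
proof -
  let ?G = "tree_graph x L i"
  have bl: "butlast b \<in> ball x L" if "b \<in> ball x L" for b
    using ball_butlast[OF that] by (auto simp: ball_def)
  have root: "[] \<in> ball x L" by (simp add: ball_def)
  have "deg ?G (i a) = port_count \<or> deg ?G (i a) = 1" if a: "a \<in> ball x L" for a
  proof (cases "length a < L")
    case True
    then obtain k where k: "L = Suc k" "a \<in> ball x k" using a by (cases L) (auto simp: ball_def)
    have "adj x a \<subseteq> ball x L" using adj_ball[OF k(2)] k(1) by simp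
    then have "inj_on i (adj x a)" by (rule inj_on_subset[OF inj])
    then have "card (i ` adj x a) = card (adj x a)" by (rule card_image)
    then show ?thesis
      using True nbrs_tree_graph[OF inj a] card_adj[OF x, of a] a by (simp add: deg_def ball_def)
  next
    case False
    then show ?thesis using L nbrs_tree_graph[OF inj a] by (auto simp: deg_def)
  qed
  moreover have "odd port_count" "1 \<le> port_count" by (simp_all add: port_count_def)
  ultimately have "odd (deg ?G (i a)) \<and> deg ?G (i a) \<le> port_count" if "a \<in> ball x L" for a
    using that by fastforce
  then have "odd (deg ?G v) \<and> deg ?G v \<le> port_count" if "v \<in> fst ?G" for v
    using that unfolding tree_graph_def by auto
  moreover have "simple_graph ?G"
  proof -
    have "card {i a, i (butlast a)} = 2" if "a \<in> ball x L" "a \<noteq> []" for a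
    proof -
      have "a \<noteq> butlast a" using that(2)
          by (metis append_butlast_last_id append_self_conv list.distinct(1))
      then have "i a \<noteq> i (butlast a)" using inj_onD[OF inj] that(1) bl by blast
      then show ?thesis by simp
    qed
    then show ?thesis
      using bl root finite_ball by (auto simp: simple_graph_def tree_graph_def)
  qed
  moreover have "connected_graph ?G"
  proof (rule connected_graphI[of "i []"])
    show "i [] \<in> fst ?G" using root by (auto simp: tree_graph_def)
    have "(i [], i a) \<in> (edge_rel ?G)\<^sup>*" if "a \<in> ball x L" for a
      using that
    proof (induction a rule: rev_induct)
      case (snoc r a)
      have "a \<in> ball x L" using bl[OF snoc.prems] by simp
      then have "(i [], i a) \<in> (edge_rel ?G)\<^sup>*" by (rule snoc.IH)
      moreover have "{i (a @ [r]), i (butlast (a @ [r]))} \<in> snd ?G"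
        unfolding tree_graph_def using snoc.prems by (auto simp del: butlast_snoc)
      then have "(i a, i (a @ [r])) \<in> edge_rel ?G" by (simp add: edge_rel_def insert_commute)
      ultimately show ?case by (rule rtrancl_into_rtrancl)
    qed simp
    then show "(i [], u) \<in> (edge_rel ?G)\<^sup>*" if "u \<in> fst ?G" for u
      using that by (auto simp: tree_graph_def)
  qed
  ultimately show ?thesis by (simp add: odd_graph_def)
qed

lemma ex_address:
  assumes x: "valid_tree x" and m: "0 < m"
  shows "\<exists>a. reduced x a \<and> length a = L"
proof (induction L)
  case (Suc L)
  then obtain a where a: "reduced x a" "length a = L" by blast
  \<comment> \<open>One of \<open>0\<close> and \<open>1\<close> does not lead back, and both are
    ports because \<open>0 < m\<close>.\<close>
  define r where "r = (if x a = 0 then 1 else 0 :: nat)"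
  have "r < port_count" "r \<noteq> x a" using m by (auto simp: r_def port_count_def)
  then have "reduced x (a @ [r])" using a by (simp add: reduced_snoc)
  then show ?case using a(2) by (metis length_append_singleton)
qed (intro exI[of _ "[]"], simp)

text \<open>The padding hangs at a leaf of depth exactly \<open>L\<close>, so the neighborhoods at
  smaller depth are untouched, and the root attains the maximum degree. The identifiers are
  precisely \<open>{1..n}\<close>, which is why exponent 1 is reached.\<close>

lemma ex_padded_tree:
  assumes x: "valid_tree x" and m: "0 < m" and L: "0 < L"
    and i: "bij_betw i (ball x L) S" and S: "S \<subseteq> {1..n}" "card S = s" "n = s + 2 * j"
  shows "\<exists>G. odd_instance 1 G \<and> fst G = {1..n} \<and> max_deg G = port_count \<and>
    (\<forall>a. reduced x a \<longrightarrow> length a < L \<longrightarrow> nbrs G (i a) = i ` adj x a)"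
proof -
  have inj: "inj_on i (ball x L)" and im: "i ` ball x L = S" using i by (auto simp: bij_betw_def)
  define E where "E = snd (tree_graph x L i)"
  have G0: "tree_graph x L i = (S, E)" using im by (simp add: tree_graph_def E_def)
  obtain l where l: "reduced x l" "length l = L" using ex_address[OF x m] by blast
  have lb: "l \<in> ball x L" using l by (simp add: ball_def)
  have "l \<noteq> []" using l L by auto
  then have dl: "deg (S, E) (i l) = 1"
    using nbrs_tree_graph[OF inj lb] l unfolding G0 by (simp add: deg_def)
  have "card ({1..n} - S) = 2 * j"
    using S by (simp add: card_Diff_subset finite_subset)
  moreover have "odd_graph port_count (S, E)" using odd_tree_graph[OF x L inj] G0 by simp
  moreover have "i l \<in> S" using lb im by blast
  moreover have "3 \<le> port_count" using m by (simp add: port_count_def)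
  ultimately have "\<exists>E'. odd_graph port_count (S \<union> ({1..n} - S), E') \<and>
      (\<forall>v\<in>S - {i l}. nbrs (S \<union> ({1..n} - S), E') v = nbrs (S, E) v)"
    using dl by (intro pad_odd_graph) auto
  moreover have "S \<union> ({1..n} - S) = {1..n}" using S(1) by blast
  ultimately obtain E' where E': "odd_graph port_count ({1..n}, E')"
      "\<forall>v\<in>S - {i l}. nbrs ({1..n}, E') v = nbrs (S, E) v" by auto
  let ?G = "({1..n}, E')"
  have nb: "nbrs ?G (i a) = i ` adj x a" if a: "reduced x a" "length a < L" for a
  proof -
    have ab: "a \<in> ball x L" using a by (simp add: ball_def)
    have "a \<noteq> l" using a l by auto
    then have "i a \<noteq> i l" using inj_onD[OF inj] ab lb by blast
    then have "nbrs ?G (i a) = nbrs (S, E) (i a)" using E'(2) ab im by blast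
    then show ?thesis using nbrs_tree_graph[OF inj ab] a(2) G0 by simp
  qed
  have deg_le: "deg ?G v \<le> port_count" if "v \<in> {1..n}" for v using E'(1) that
      by (simp add: odd_graph_def)
  have root: "[] \<in> ball x L" by (simp add: ball_def)
  then have iv: "i [] \<in> {1..n}" using im S(1) by blast
  obtain k where k: "L = Suc k" using L by (cases L) auto
  have "[] \<in> ball x k" by (simp add: ball_def)
  then have "adj x [] \<subseteq> ball x L" using adj_ball[of "[]" x k] k by simp
  then have "inj_on i (adj x [])" by (rule inj_on_subset[OF inj])
  then have dr: "deg ?G (i []) = port_count"
    using nb[of "[]"] L card_adj[OF x, of "[]"] by (simp add: deg_def card_image)
  have "port_count \<in> deg ?G ` {1..n}" using iv dr[symmetric] by (rule rev_image_eqI)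
  then have "max_deg ?G = port_count"
    unfolding max_deg_def using deg_le by (intro Max_eqI) auto
  moreover have "odd_instance 1 ?G"
    using E'(1) by (auto simp: odd_instance_def odd_graph_def)
  ultimately show ?thesis using nb by (intro exI[of _ ?G]) auto
qed


definition before :: "ptree \<Rightarrow> nat list \<Rightarrow> nat list \<Rightarrow> bool" where
  "before x a b \<longleftrightarrow> 0 < path_value x a b"

lemma ex_before_iso:
  assumes "valid_tree x" "finite S" "card S = ball_size t"
  shows "\<exists>f. order_iso (ball x t) (before x) S f"
proof (rule ex_order_iso)
  show "card S = card (ball x t)" using assms card_ball by simp
  show "before x a c" if "before x a b" "before x b c" for a b c
    using that path_value_trans unfolding before_def by blast
  show "\<not> before x a a" for a by (simp add: before_def)
  show "before x a b \<or> before x b a" if "a \<in> ball x t" "b \<in> ball x t" "a \<noteq> b" for a b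
    using that path_value_total unfolding before_def ball_def by blast
qed (use assms finite_ball in auto)

text \<open>The output of the root of \<open>x\<close> when the identifiers in \<open>S\<close> are placed in the order of the tree.\<close>

definition simulated_output :: "algorithm \<Rightarrow> nat \<Rightarrow> nat \<Rightarrow> ptree \<Rightarrow> nat set \<Rightarrow> nat" where
  "simulated_output Alg n t x S = (let e =
      (SOME f. order_iso (ball x t) (before x) S f) in Alg n port_count (canonical_view x t e) (e []))"

lemma simulated_output_cong:
  assumes "agree t x y"
  shows "simulated_output Alg n t x S = simulated_output Alg n t y S"
proof -
  have b: "ball x t = ball y t" using ball_cong[OF assms] .
  have "before x a b = before y a b" if "a \<in> ball y t" "b \<in> ball y t" for a b
    using path_value_cong[OF assms] that by (simp add: before_def ball_def)
  then have "order_iso (ball x t) (before x) S f = order_iso (ball y t) (before y) S f" for f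
    unfolding order_iso_def b by simp
  then have "order_iso (ball y t) (before x) S = order_iso (ball y t) (before y) S"
    unfolding b by (rule ext)
  then show ?thesis unfolding simulated_output_def canonical_view_def b by (simp only:)
qed

text \<open>The placement \<open>e\<close> is itself an order isomorphism, so by uniqueness it
  coincides on the ball with the one picked in \<open>simulated_output\<close>.\<close>

lemma run_eq_simulated_output:
  assumes x: "valid_tree x" and G: "simple_graph G" "max_deg G = port_count" "e [] \<in> fst G"
    and inj: "inj_on e (ball x (Suc (T port_count)))"
    and nb: "\<And>a. a \<in> ball x (T port_count) \<Longrightarrow> nbrs G (e a) = e ` adj x a"
    and mono: "\<And>a b. a \<in> ball x (T port_count) \<Longrightarrow> b \<in> ball x (T port_count) \<Longrightarrow> before x a b \<longleftrightarrow> e a < e b"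
  shows "run Alg T G (e []) = simulated_output Alg (card (fst G)) (T port_count) x (e ` ball x (T port_count))"
proof -
  let ?t = "T port_count" and ?S = "e ` ball x (T port_count)"
  define f where "f = (SOME f. order_iso (ball x ?t) (before x) ?S f)"
  have "inj_on e (ball x ?t)" using inj by (rule inj_on_subset) (auto simp: ball_def)
  then have e: "order_iso (ball x ?t) (before x) ?S e"
    using mono by (simp add: order_iso_def bij_betw_def)
  have f: "order_iso (ball x ?t) (before x) ?S f"
    unfolding f_def using someI[of "order_iso (ball x ?t) (before x) ?S", OF e] .
  have ef: "e a = f a" if "a \<in> ball x ?t" for a
    using order_iso_unique[OF e f _ that] finite_ball by simp
  have "[] \<in> ball x ?t" by (simp add: ball_def)
  then have "e [] = f []" by (rule ef)
  moreover have "canonical_view x ?t e = canonical_view x ?t f" using ef by (rule canonical_view_cong)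
  moreover have "local_view G ?t (e []) = canonical_view x ?t e"
    using local_view_eq_canonical_view[OF x G(1,3) inj nb] .
  ultimately show ?thesis unfolding run_def simulated_output_def f_def[symmetric] G(2) by simp
qed

section \<open>Homogeneous sets of identifiers\<close>

definition restrict_depth :: "nat \<Rightarrow> ptree \<Rightarrow> ptree" where
  "restrict_depth t x = (\<lambda>a. if length a \<le> t then x a else 0)"

lemma restrict_depth_eq_iff: "restrict_depth t x = restrict_depth t y \<longleftrightarrow> agree t x y"
  unfolding restrict_depth_def agree_def fun_eq_iff by metis

text \<open>Truncated trees represent the classes of \<open>agree t\<close>. The Ramsey colors below
  are sets of such classes, so finiteness bounds the number of colors.\<close>

lemma finite_restrict_depth: "finite (restrict_depth t ` Collect valid_tree)"
proof (rule finite_subset)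
  let ?A = "{a. set a \<subseteq> {..<port_count} \<and> length a \<le> t}"
  show "restrict_depth t ` Collect valid_tree \<subseteq> {f. \<forall>a. (a \<in> ?A \<longrightarrow> f a \<in> {..port_count}) \<and> (a \<notin> ?A \<longrightarrow> f a = 0)}"
  proof (intro image_subsetI CollectI allI)
    fix x assume "x \<in> Collect valid_tree"
    then have x: "valid_tree x" by simp
    have sub: "set a \<subseteq> {..<port_count}" if "reduced y a" for a y
      using that by (induction a arbitrary: y) auto
    have "x a \<le> port_count \<and> (\<not> set a \<subseteq> {..<port_count} \<longrightarrow> x a = 0)" for a
    proof (cases "reduced x a")
      case True
      then show ?thesis
        using sub[OF True] valid_tree_Nil[OF x] entry_less[OF x True] by (cases "a = []") auto
    next
      case False
      then show ?thesis using x by (simp add: valid_tree_def valid_branch_def)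
    qed
    then show "(a \<in> ?A \<longrightarrow> restrict_depth t x a \<in> {..port_count}) \<and> (a \<notin> ?A \<longrightarrow> restrict_depth t x a = 0)" for a
      by (simp add: restrict_depth_def)
  qed
  show "finite {f. \<forall>a. (a \<in> ?A \<longrightarrow> f a \<in> {..port_count}) \<and> (a \<notin> ?A \<longrightarrow> f a = 0)}"
    by (intro finite_set_of_finite_funs finite_lists_length_le) auto
qed

text \<open>A set of identifiers is colored by the truncated trees on which the output is 1. The
  Ramsey number \<open>N\<close> depends only on the number of colors, so \<open>n\<close> can be
  fixed before the coloring, which refers to the output for this \<open>n\<close>.\<close>

lemma ex_homogeneous_ids:
  "\<exists>n j S. n = ball_size L + 2 * j \<and> S \<subseteq> {1..n} \<and> card S = ball_size L \<and>
    (\<forall>X Y x. X \<subseteq> S \<longrightarrow> Y \<subseteq> S \<longrightarrow> card X = ball_size t \<longrightarrow> card Y = ball_size t \<longrightarrow> valid_tree x \<longrightarrow>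
       simulated_output Alg n t x X = 1 \<longrightarrow> simulated_output Alg n t x Y = 1)"
proof -
  define C where "C = Pow (restrict_depth t ` Collect valid_tree)"
  have finC: "finite C" unfolding C_def using finite_restrict_depth by simp
  obtain h where h: "bij_betw h C {0..<card C}" using ex_bij_betw_finite_nat[OF finC] by blast
  obtain N :: nat where N: "partn_lst {..<N} (replicate (card C) (ball_size L)) (ball_size t)"
    using ramsey_full[of "replicate (card C) (ball_size L)" "ball_size t"] by blast
  \<comment> \<open>There is room for the \<open>N\<close> identifiers from which Ramsey's theorem
    selects, and the number of padding nodes is even.\<close>
  define n where "n = ball_size L + 2 * N"
  define ch where "ch X = restrict_depth t ` {x. valid_tree x \<and>
      simulated_output Alg n t x (Suc ` X) = 1}" for X
  have chC: "ch X \<in> C" for X unfolding ch_def C_def by auto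
  have "(\<lambda>X. h (ch X)) \<in> nsets {..<N} (ball_size t) \<rightarrow> {..<length (replicate (card C) (ball_size L))}"
    using bij_betwE[OF h] chC by auto
  then obtain k where k: "k < card C"
      "monochromatic {..<N} (ball_size L) (ball_size t) (\<lambda>X. h (ch X)) k"
    using N unfolding partn_lst_def by fastforce
  then obtain H where H: "H \<in> nsets {..<N} (ball_size L)"
      "(\<lambda>X. h (ch X)) ` nsets H (ball_size t) \<subseteq> {k}"
    unfolding monochromatic_def by blast
  define S where "S = Suc ` H"
  have HN: "H \<subseteq> {..<N}" "finite H" "card H = ball_size L" using H(1) by (auto simp: nsets_def)
  have "S \<subseteq> {1..n}" using HN(1) unfolding S_def n_def by auto
  moreover have "card S = ball_size L" unfolding S_def using HN(3) by (simp add: card_image)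
  moreover have "simulated_output Alg n t x Y = 1"
    if XY: "X \<subseteq> S" "Y \<subseteq> S" "card X = ball_size t" "card Y = ball_size t"
        "valid_tree x" "simulated_output Alg n t x X = 1" for X Y x
  proof -
    have pre: "\<exists>Z\<in>nsets H (ball_size t). Z' = Suc ` Z" if Z': "Z' \<subseteq> S" "card Z' = ball_size t" for Z'
    proof -
      obtain Z where Z: "Z \<subseteq> H" "Z' = Suc ` Z" using Z'(1) unfolding S_def by (meson subset_imageE)
      have "card Z = ball_size t" using Z'(2) Z(2) by (simp add: card_image)
      then show ?thesis using Z HN(2) finite_subset by (auto simp: nsets_def)
    qed
    obtain X' where X': "X' \<in> nsets H (ball_size t)" "X = Suc ` X'" using pre[OF XY(1,3)] by blast
    obtain Y' where Y': "Y' \<in> nsets H (ball_size t)" "Y = Suc ` Y'" using pre[OF XY(2,4)] by blast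
    have "h (ch X') = h (ch Y')" using H(2) X'(1) Y'(1) by blast
    then have "ch X' = ch Y'" using inj_onD[OF bij_betw_imp_inj_on[OF h]] chC by blast
    moreover have "restrict_depth t x \<in> ch X'" unfolding ch_def using XY(5,6) X'(2) by blast
    ultimately obtain y where y: "valid_tree y" "simulated_output Alg n t y Y = 1" "restrict_depth t x =
        restrict_depth t y"
      unfolding ch_def Y'(2) by auto
    then show ?thesis using simulated_output_cong restrict_depth_eq_iff by metis
  qed
  ultimately show ?thesis using n_def by blast
qed

text \<open>On homogeneous identifiers \<open>f\<close> tells whether the root outputs 1. A port
  demands if its neighbor has the other value, no port accepts, and \<open>key\<close> provides a
  demanding port. Looking at the neighbors costs the extra round.\<close>

lemma superweak_of_local:
  assumes m: "0 < m" and c: "1 \<le> c" and solves: "solves_weak2_odd c Alg T"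
  shows "\<exists>col D A. superweak (Suc (T port_count)) 2 col D A"
proof -
  define t where "t = T port_count"
  \<comment> \<open>The neighbors of the root are simulated too: their balls of radius
    \<open>t\<close>, together with the next layer, reach depth \<open>t + 2\<close>.\<close>
  define L where "L = Suc (Suc t)"
  obtain n j S where n: "n = ball_size L + 2 * j" and S: "S \<subseteq> {1..n}" "card S = ball_size L"
    and hom: "\<And>X Y x. X \<subseteq> S \<Longrightarrow> Y \<subseteq> S \<Longrightarrow> card X = ball_size t \<Longrightarrow> card Y = ball_size t \<Longrightarrow> valid_tree x \<Longrightarrow>
       simulated_output Alg n t x X = 1 \<Longrightarrow> simulated_output Alg n t x Y = 1"
    using ex_homogeneous_ids[of L t Alg] by blast
  define f where "f x \<longleftrightarrow> (\<exists>X\<subseteq>S. card X = ball_size t \<and> simulated_output Alg n t x X = 1)" for x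
  have f: "f x \<longleftrightarrow> simulated_output Alg n t x X = 1" if "valid_tree x" "X \<subseteq> S" "card X = ball_size t" for x X
    unfolding f_def using hom that by blast
  have f_cong: "f x = f y" if "agree t x y" for x y
    unfolding f_def using simulated_output_cong[OF that] by simp
  have key: "\<exists>p<port_count. f (reroot x p) \<noteq> f x" if x: "valid_tree x" for x
  proof -
    have finS: "finite S" using S(1) finite_subset by blast
    obtain i where i: "order_iso (ball x L) (before x) S i"
      using ex_before_iso[OF x finS S(2)] by blast
    have bij: "bij_betw i (ball x L) S" and
      imono: "\<And>a b. a \<in> ball x L \<Longrightarrow> b \<in> ball x L \<Longrightarrow> before x a b \<longleftrightarrow> i a < i b"
      using i by (auto simp: order_iso_def)
    have inj: "inj_on i (ball x L)" and im: "i ` ball x L = S" using bij by (auto simp: bij_betw_def)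
    obtain G where G: "odd_instance 1 G" "fst G = {1..n}" "max_deg G = port_count"
      and nb: "\<And>a. reduced x a \<Longrightarrow> length a < L \<Longrightarrow> nbrs G (i a) = i ` adj x a"
      using ex_padded_tree[OF x m _ bij S(1) S(2) n] L_def by auto
    have sg: "simple_graph G" and nG: "card (fst G) = n" using G by (auto simp: odd_instance_def)
    have "odd_instance c G"
    proof -
      have "n \<le> n ^ c" using c by (cases "n = 0") (auto intro: self_le_power)
      then have "{1..n} \<subseteq> {1..n ^ c}" by auto
      then show ?thesis using G(1,2) nG by (auto simp: odd_instance_def)
    qed
    then have weak: "weak_2_coloring G (run Alg T G)" using solves unfolding solves_weak2_odd_def by blast
    have iG: "i a \<in> fst G" if "a \<in> ball x L" for a using that im S(1) G(2) by blast
    have root: "[] \<in> ball x L" by (simp add: ball_def)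
    have sub: "ball x k \<subseteq> ball x L" if "k \<le> L" for k using that by (auto simp: ball_def)
    have runr: "f x \<longleftrightarrow> run Alg T G (i []) = 1"
    proof -
      have "run Alg T G (i []) =
          simulated_output Alg (card (fst G)) (T port_count) x (i ` ball x (T port_count))"
      proof (rule run_eq_simulated_output[where e = i and T = T, OF x sg G(3) iG[OF root]])
        show "inj_on i (ball x (Suc (T port_count)))"
          using inj_on_subset[OF inj sub[of "Suc t"]] by (simp add: t_def L_def)
        show "nbrs G (i a) = i ` adj x a" if "a \<in> ball x (T port_count)" for a
          using that nb by (simp add: ball_def L_def t_def)
        show "before x a b \<longleftrightarrow> i a < i b" if "a \<in> ball x (T port_count)"
            "b \<in> ball x (T port_count)" for a b
          using that imono sub[of t] by (auto simp: t_def L_def)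
      qed
      moreover have "i ` ball x t \<subseteq> S" using im sub[of t] by (auto simp: L_def)
      moreover have "card (i ` ball x t) = ball_size t"
        using card_ball[OF x, of t] card_image[OF inj_on_subset[OF inj sub[of t]]] by (simp add: L_def)
      ultimately show ?thesis using f[OF x, of "i ` ball x t"] nG by (simp add: t_def)
    qed
    have runp: "f (reroot x p) \<longleftrightarrow> run Alg T G (i [p]) = 1" if p: "p < port_count" for p
    proof -
      let ?y = "reroot x p" and ?e = "\<lambda>a. i (reroot_address x p a)"
      have y: "valid_tree ?y" using valid_tree_reroot[OF x p] .
      have rb: "reroot_address x p a \<in> ball x (Suc k)" if "a \<in> ball ?y k" for a k
        using reduced_reroot_address[OF x p, of a] length_reroot_address[of x p a] that by (auto simp: ball_def)
      have rb': "reroot_address x p a \<in> ball x L" if "a \<in> ball ?y k" "k \<le> Suc t" for a k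
        using rb[OF that(1)] sub[of "Suc k"] that(2) by (auto simp: L_def)
      have einj: "inj_on ?e (ball ?y (Suc t))"
      proof (rule inj_onI)
        fix a b assume ab: "a \<in> ball ?y (Suc t)" "b \<in> ball ?y (Suc t)" "?e a = ?e b"
        then have "reroot_address x p a = reroot_address x p b" using inj_onD[OF inj] rb' by blast
        then show "a = b" using inj_reroot_address[OF x, of p a b] ab by (simp add: ball_def)
      qed
      have "run Alg T G (?e []) =
          simulated_output Alg (card (fst G)) (T port_count) ?y (?e ` ball ?y (T port_count))"
      proof (rule run_eq_simulated_output[where e = ?e and T = T, OF y sg G(3)])
        show "?e [] \<in> fst G" using iG rb'[of "[]" 0] by (simp add: ball_def)
        show "inj_on ?e (ball ?y (Suc (T port_count)))" using einj by (simp add: t_def)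
        show "nbrs G (?e a) = ?e ` adj ?y a" if "a \<in> ball ?y (T port_count)" for a
        proof -
          have "reroot_address x p a \<in> ball x (Suc t)" using rb that by (simp add: t_def)
          then have "nbrs G (?e a) = i ` adj x (reroot_address x p a)" by (intro nb) (auto simp: ball_def L_def)
          also have "adj x (reroot_address x p a) = reroot_address x p ` adj ?y a"
            using reroot_address_adj[OF x p, of a] that by (simp add: ball_def)
          finally show ?thesis by (simp add: image_image)
        qed
        show "before ?y a b \<longleftrightarrow> ?e a < ?e b" if "a \<in> ball ?y (T port_count)"
            "b \<in> ball ?y (T port_count)" for a b
        proof -
          have "before ?y a b \<longleftrightarrow> before x (reroot_address x p a) (reroot_address x p b)"
            using path_value_reroot[OF x p, of a b] that by (simp add: ball_def before_def)
          also have "\<dots> \<longleftrightarrow> ?e a < ?e b" using that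
              by (intro imono rb'[of _ t]) (auto simp: t_def)
          finally show ?thesis .
        qed
      qed
      moreover have "?e ` ball ?y t \<subseteq> S" using im rb'[of _ t] by auto
      moreover have "ball ?y t \<subseteq> ball ?y (Suc t)" by (auto simp: ball_def)
      then have "card (?e ` ball ?y t) = ball_size t"
        using card_ball[OF y, of t] card_image[OF inj_on_subset[OF einj]] by simp
      ultimately show ?thesis using f[OF y, of "?e ` ball ?y t"] nG by (simp add: t_def)
    qed
    have nr: "nbrs G (i []) = i ` adj x []" using nb by (simp add: L_def)
    have adj0: "adj x [] = (\<lambda>r. [r]) ` {..<port_count}" using valid_tree_Nil[OF x]
        by (simp add: adj_def)
    have "deg G (i []) \<ge> 1"
      using G(1) iG[OF root] by (auto simp: odd_instance_def intro: odd_pos Suc_leI)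
    then obtain u where u: "u \<in> nbrs G (i [])" "run Alg T G u \<noteq> run Alg T G (i [])"
      using weak iG[OF root] by (auto simp: weak_2_coloring_def)
    then obtain p where p: "p < port_count" "u = i [p]" using nr adj0 by auto
    have "u \<in> fst G" using nbrs_in[OF sg u(1)] by blast
    then have "run Alg T G u \<in> {1, 2}" "run Alg T G (i []) \<in> {1, 2}"
      using weak iG[OF root] by (auto simp: weak_2_coloring_def)
    then have "f (reroot x p) \<noteq> f x" using runr runp[OF p(1)] u(2) p(2) by auto
    then show ?thesis using p(1) by blast
  qed
  have "superweak (Suc t) 2 (\<lambda>x. if f x then 0 else 1) (\<lambda>x. {p. p < port_count \<and>
      f (reroot x p) \<noteq> f x}) (\<lambda>_. {})"
    unfolding superweak_def
  proof (intro conjI allI impI)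
    fix x y assume xy: "agree (Suc t) x y"
    have "f x = f y" using f_cong agree_mono[OF xy, of t] by simp
    moreover have "f (reroot x p) = f (reroot y p)" for p using f_cong agree_reroot_Suc[OF xy] by blast
    ultimately show "(if f x then 0 else 1::nat) = (if f y then 0 else 1)"
      "{p. p < port_count \<and> f (reroot x p) \<noteq> f x} = {p. p < port_count \<and> f (reroot y p) \<noteq> f y}" by auto
  next
    fix x assume "valid_tree x"
    then have "{p. p < port_count \<and> f (reroot x p) \<noteq> f x} \<noteq> {}" using key by blast
    then show "card ({} :: nat set) < card {p. p < port_count \<and> f (reroot x p) \<noteq> f x}"
      by (simp add: card_gt_0_iff)
  qed auto
  then show ?thesis unfolding t_def by blast
qed

end

theorem theorem9:
  fixes c :: nat
  assumes "c \<ge> 1"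
  shows "\<not> (\<exists>(A :: algorithm) (T :: nat \<Rightarrow> nat).
            (\<lambda>d. real (T d)) \<in> o(\<lambda>d. real (log_star (real d))) \<and> solves_weak2_odd c A T)"
proof (intro notI, elim exE conjE)
  fix A :: algorithm and T :: "nat \<Rightarrow> nat"
  assume o: "(\<lambda>d. real (T d)) \<in> o(\<lambda>d. real (log_star (real d)))" and solves:
      "solves_weak2_odd c A T"
  \<comment> \<open>Each round costs seven exponentials; the factor 2 in 14 leaves half of
    \<open>h\<close> to absorb additive constants.\<close>
  have "eventually (\<lambda>d. norm (real (T d)) \<le> 1/14 * norm (real (log_star (real d)))) sequentially"
    by (rule landau_o.smallD[OF o]) simp
  then obtain d0 where d0: "\<And>d. d0 \<le> d \<Longrightarrow> real (T d) \<le> 1/14 * real (log_star (real d))"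
    by (auto simp: eventually_sequentially)
  \<comment> \<open>\<open>d0\<close> brings \<open>port_count\<close> into the range of the bound
    on \<open>T\<close>; the 20 is for deducing \<open>8 + 7 * T port_count \<le> h\<close> from
    \<open>14 * T port_count \<le> h + 2\<close>, which works from \<open>h = 18\<close> on.\<close>
  define h where "h = d0 + 20"
  \<comment> \<open>Just above \<open>tower h\<close>, as \<open>no_superweak\<close> asks for a
    strict inequality, while \<open>port_count\<close> stays below \<open>tower (h + 2)\<close>, so
    its \<open>log_star\<close> is at most \<open>h + 2\<close>.\<close>
  define m where "m = Suc (tower h)"
  interpret ported_trees m .
  have port_count: "port_count = 2 * tower h + 3" by (simp only: port_count_def) (simp add: m_def)
  have "h \<le> tower h" using strict_mono_imp_increasing[OF strict_mono_tower] .
  then have "d0 \<le> port_count" unfolding port_count by (simp add: h_def)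
  then have "real (T port_count) \<le> 1/14 * real (log_star (real port_count))" by (rule d0)
  moreover have "port_count \<le> tower (Suc (Suc h))"
  proof -
    have "tower h + 1 \<le> 2 ^ tower h" by (simp add: Suc_leI)
    then have "2 * tower h + 3 \<le> 2 * 2 ^ tower h + 1" by simp
    also have "\<dots> \<le> 2 ^ 2 ^ tower h"
    proof -
      have "3 \<le> tower h" using \<open>h \<le> tower h\<close> by (simp add: h_def)
      then have "(2::nat) ^ 3 \<le> 2 ^ tower h" by (intro power_increasing) auto
      then have "3 \<le> (2::nat) ^ tower h" by simp
      moreover have "2 * k + 1 \<le> 2 ^ k" if "3 \<le> k" for k :: nat
        using that by (induction k rule: dec_induct) auto
      ultimately show ?thesis by blast
    qed
    finally show ?thesis unfolding port_count by simp
  qed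
  then have "log_star (real port_count) \<le> Suc (Suc h)" by (intro log_star_le_tower) simp
  ultimately have "14 * T port_count \<le> h + 2" by linarith
  then have "1 + 7 * Suc (T port_count) \<le> h" by (simp add: h_def)
  then have "tower (1 + 7 * Suc (T port_count)) < m"
    using strict_mono_less_eq[OF strict_mono_tower] by (simp add: m_def less_Suc_eq_le)
  then have "\<not> superweak (Suc (T port_count)) (tower 1) col D B" for col D B by (rule no_superweak)
  moreover have "tower 1 = 2" by simp
  moreover have "\<exists>col D B. superweak (Suc (T port_count)) 2 col D B"
    by (rule superweak_of_local[OF _ assms solves]) (simp add: m_def)
  ultimately show False by simp
qed

end
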